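(* Let $0<L\le U$, let $k\ge1$ be an integer, $\delta\in(0,1]$, and consider ROS-$(\delta,\Delta)$ with $\Delta=0$. For $\alpha\ge1$ put $\tau_\delta(\alpha)=1-\delta+\frac{\delta}{\alpha}$ and define $\phi_{1,\alpha}:[0,1]\to\mathbb R$ by $$\phi_{1,\alpha}(x)=\begin{cases}L, & x\in[0,\tau_\delta(\alpha)],\\[2mm] L\left[1+\displaystyle\sum_{j=1}^{N_\alpha(x)}\frac{(\alpha/\delta)^j}{j!}\Big(x-1+\delta\big(1-\tfrac1\alpha\big)-(j-1)(1-\delta)\Big)^j\right], & x\in[\tau_\delta(\alpha),1],\end{cases}$$ where $N_\alpha(x)=\left\lfloor\frac{x-1+\delta-\delta/\alpha}{1-\delta}\right\rfloor+1$ (for $\delta=1$ the sum is read as the infinite series, $N_\alpha(x)=\infty$). Let $\alpha^{\mathsf{SP}}_\delta$ be the unique solution $\alpha\ge 1$ of $\phi_{1,\alpha}(1)=U$. Then cPPM-$\boldsymbol\phi$ with $q_1=k$ and the single pricing function $\phi_1=\phi_{1,\alpha^{\mathsf{SP}}_\delta}$ has $\mathsf{CVaR}_\delta\text{-CR}$ equal to $\alpha^{\mathsf{SP}}_\delta$, and this is optimal among all fully-static pricing schemes: every fully-static pricing scheme has $\mathsf{CVaR}_\delta\text{-CR}$ at least $\alpha^{\mathsf{SP}}_\delta$.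
   Context: Problem ROS-$(\delta,\Delta)$ (with $\delta\in(0,1]$, $\Delta\in\{0,\dots,k-1\}$): a seller has $k$ identical units. Buyers $t=1,\dots,T$ arrive one by one; buyer $t$ has a private value $v_t\in[L,U]$, where $0<L\le U$ are known. When buyer $t$ arrives the seller posts a price $p_t$; if units remain, the buyer accepts and buys one unit ($x_t=1$) if $v_t\ge p_t$ and otherwise leaves ($x_t=0$). At most $k$ units can be sold. Prices are chosen (possibly at random) without knowing the future values or $T$, and must satisfy $\sum_{t=1}^{T-1}\mathbf 1\{p_t\ne p_{t+1}\}\le\Delta$. For an instance $I=(v_1,\dots,v_T)$, $\mathrm{ALG}(I,P)=\sum_t v_tx_t$ is the (random) social welfare, and $\mathrm{OPT}(I)$ is the sum of the $k$ highest values in $I$ (all values if $T<k$). $\mathsf{CVaR}_\delta[X]=\sup_{\tau\in\mathbb R}\{\tau-\frac1\delta\mathbb E[(\tau-X)_+]\}$, where $(x)_+=\max\{x,0\}$. $\mathsf{CVaR}_\delta\text{-CR}(\mathrm{ALG})=\sup_I \mathrm{OPT}(I)/\mathsf{CVaR}_\delta[\mathrm{ALG}(I,P)]$, the supremum being over all instances (any $T\ge1$, any values in $[L,U]$), with value $+\infty$ if some denominator is $0$. A fully-static pricing scheme ($\Delta=0$) draws one random price $P$ from some distribution and posts $p_t=P$ to every buyer; thus the first (at most) $k$ buyers with $v_t\ge P$ each get a unit. The mechanism cPPM-$\boldsymbol\phi$ with $\Delta=0$ and $q_1=k$ draws a seed $R$ uniformly from $[0,1]$ and is the fully-static scheme with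 $P=\phi_1(R)$. *)

theory Defs
  imports "HOL-Probability.Probability"
begin

definition instances :: "real \<Rightarrow> real \<Rightarrow> real list set" where
  "instances L U = {vs. vs \<noteq> [] \<and> set vs \<subseteq> {L..U}}"

text \<open>
  \<open>welfare s p vs\<close>: \<open>s\<close> units are left, the next buyers have values \<open>vs\<close>, and the \<open>t\<close>-th of them
  (counting from \<open>0\<close>) is offered a unit at price \<open>p t\<close>.
\<close>

primrec welfare :: "nat \<Rightarrow> (nat \<Rightarrow> real) \<Rightarrow> real list \<Rightarrow> real" where
  "welfare s p [] = 0"
| "welfare s p (v # vs) =
     (if s > 0 \<and> v \<ge> p 0 then v + welfare (s - 1) (\<lambda>t. p (Suc t)) vs
      else welfare s (\<lambda>t. p (Suc t)) vs)"

definition opt :: "nat \<Rightarrow> real list \<Rightarrow> real" where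
  "opt k vs = sum_list (take k (rev (sort vs)))"

definition cvar :: "real \<Rightarrow> 'a measure \<Rightarrow> ('a \<Rightarrow> real) \<Rightarrow> ereal" where
  "cvar \<delta> M X = (SUP \<tau>. ereal (\<tau> - 1 / \<delta> * (\<integral>\<omega>. max (\<tau> - X \<omega>) 0 \<partial>M)))"

text \<open>
  A fully-static pricing scheme is identified with the distribution of its single random price,
  which is posted to every buyer.
\<close>

definition static_scheme :: "real measure \<Rightarrow> bool" where
  "static_scheme D \<longleftrightarrow> prob_space D \<and> sets D = sets borel"

definition static_cvar :: "nat \<Rightarrow> real \<Rightarrow> real measure \<Rightarrow> real list \<Rightarrow> ereal" where
  "static_cvar k \<delta> D vs = cvar \<delta> D (\<lambda>P. welfare k (\<lambda>t. P) vs)"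

definition static_cvar_cr :: "real \<Rightarrow> real \<Rightarrow> nat \<Rightarrow> real \<Rightarrow> real measure \<Rightarrow> ereal" where
  "static_cvar_cr L U k \<delta> D =
     (SUP vs \<in> instances L U.
        if static_cvar k \<delta> D vs = 0 then \<infinity> else ereal (opt k vs) / static_cvar k \<delta> D vs)"

text \<open>The distribution of the price \<open>\<phi> R\<close> for a seed \<open>R\<close> uniform on \<open>[0, 1]\<close>.\<close>

definition cPPM_static :: "(real \<Rightarrow> real) \<Rightarrow> real measure" where
  "cPPM_static \<phi> = distr (uniform_measure lborel {0..1}) borel \<phi>"

definition tau :: "real \<Rightarrow> real \<Rightarrow> real" where
  "tau \<delta> \<alpha> = 1 - \<delta> + \<delta> / \<alpha>"

definition phi_term :: "real \<Rightarrow> real \<Rightarrow> real \<Rightarrow> nat \<Rightarrow> real" where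
  "phi_term \<delta> \<alpha> x j =
     (\<alpha> / \<delta>) ^ j / fact j * (x - 1 + \<delta> * (1 - 1 / \<alpha>) - (real j - 1) * (1 - \<delta>)) ^ j"

definition phi_N :: "real \<Rightarrow> real \<Rightarrow> real \<Rightarrow> nat" where
  "phi_N \<delta> \<alpha> x = nat (\<lfloor>(x - 1 + \<delta> - \<delta> / \<alpha>) / (1 - \<delta>)\<rfloor> + 1)"

text \<open>
  Only \<open>x \<in> [0, 1]\<close> is meant. At \<open>x = tau \<delta> \<alpha>\<close> both branches have the value \<open>L\<close>.
\<close>

definition phi1 :: "real \<Rightarrow> real \<Rightarrow> real \<Rightarrow> real \<Rightarrow> real" where
  "phi1 L \<delta> \<alpha> x =
     (if x \<le> tau \<delta> \<alpha> then L
      else L * (1 + (if \<delta> = 1 then (\<Sum>j. phi_term \<delta> \<alpha> x (Suc j))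
                     else (\<Sum>j = 1..phi_N \<delta> \<alpha> x. phi_term \<delta> \<alpha> x j))))"

definition alpha_SP :: "real \<Rightarrow> real \<Rightarrow> real \<Rightarrow> real" where
  "alpha_SP L U \<delta> = (THE \<alpha>. \<alpha> \<ge> 1 \<and> phi1 L \<delta> \<alpha> 1 = U)"

end

theory Submission
  imports Defs
begin

text \<open>
  \<open>\<phi> = phi1 L \<delta> \<alpha>\<close> solves the delayed Volterra equation
  \<open>\<phi> x = (\<alpha> / \<delta>) * \<integral>\<^sub>0\<^bsup>x - (1 - \<delta>)\<^esup> \<phi>\<close> for \<open>tau \<delta> \<alpha> \<le> x\<close>. If the price is \<open>\<phi> R\<close> and \<open>\<phi> x = v\<close>,
  the integral divided by \<open>\<delta>\<close> is the CVaR of \<open>\<phi> R\<close> truncated to \<open>0\<close> above \<open>v\<close>, which is therefore \<open>v / \<alpha>\<close>.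
  The welfare on any instance is at least the sum of these truncated prices over the \<open>k\<close> highest values,
  and CVaR is superadditive, so the ratio is at most \<open>\<alpha>\<close>.

  Conversely, offer an arbitrary scheme \<open>k\<close> copies of each point of a fine ascending grid of \<open>[L, v]\<close>: a price
  \<open>p \<le> v\<close> earns about \<open>k * max L p\<close> and a price above \<open>v\<close> earns nothing. A ratio at most \<open>\<beta>\<close> then forces
  the quantile function of the price, clipped to \<open>[L, U]\<close>, to be a subsolution of the Volterra equation for \<open>\<beta>\<close>,
  hence to lie below \<open>phi1 L \<delta> \<beta>\<close>. The bound for \<open>v = U\<close> gives \<open>U \<le> phi1 L \<delta> \<beta> 1\<close>, and
  \<open>phi1 L \<delta> \<beta> 1\<close> is strictly increasing in \<open>\<beta>\<close>.
\<close>

subsection \<open>The pricing function as a series\<close>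

text \<open>
  Clipping the base at \<open>0\<close> kills exactly the terms beyond \<open>phi_N\<close>, so that one infinite series covers
  \<open>\<delta> < 1\<close>, \<open>\<delta> = 1\<close> and \<open>x \<le> tau \<delta> \<alpha>\<close>.
\<close>

definition phi_base :: "real \<Rightarrow> real \<Rightarrow> real \<Rightarrow> nat \<Rightarrow> real" where
  "phi_base \<delta> \<alpha> x j = max 0 (x - tau \<delta> \<alpha> - (real j - 1) * (1 - \<delta>))"

definition phi_coef :: "real \<Rightarrow> real \<Rightarrow> real \<Rightarrow> nat \<Rightarrow> real" where
  "phi_coef \<delta> \<alpha> x j = (\<alpha> / \<delta>) ^ j / fact j * phi_base \<delta> \<alpha> x j ^ j"

lemma phi_coef_0 [simp]: "phi_coef \<delta> \<alpha> x 0 = 1"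
  by (simp add: phi_coef_def)

lemma summable_power_div_fact: "summable (\<lambda>j. (y::real) ^ j / fact j)"
  using summable_exp[of y] by (simp add: field_simps)

text \<open>An exponent of at least 2 makes the clipped power differentiable at the kink
  \<open>a\<close>: the difference quotient there is \<open>max 0 h ^ Suc n\<close>, which tends to
  0.\<close>

lemma DERIV_max_0_power:
  "((\<lambda>x::real. max 0 (x - a) ^ Suc (Suc n)) has_real_derivative real (Suc (Suc n)) * max 0 (x - a) ^ Suc n) (at x)"
proof (cases x a rule: linorder_cases)
  case less
  have "((\<lambda>x. 0) has_real_derivative 0) (at x)" by simp
  then have "((\<lambda>x::real. max 0 (x - a) ^ Suc (Suc n)) has_real_derivative 0) (at x)"
    by (rule has_field_derivative_transform_within_open[where S="{..<a}"]) (use less in auto)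
  with less show ?thesis by simp
next
  case greater
  have "((\<lambda>x. (x - a) ^ Suc (Suc n)) has_real_derivative real (Suc (Suc n)) * (x - a) ^ Suc n) (at x)"
    by (rule derivative_eq_intros refl)+ simp
  then have "((\<lambda>x::real. max 0 (x - a) ^ Suc (Suc n)) has_real_derivative real (Suc (Suc n)) * (x - a) ^ Suc n) (at x)"
    by (rule has_field_derivative_transform_within_open[where S="{a<..}"]) (use greater in auto)
  with greater show ?thesis by simp
next
  case equal
  have "((\<lambda>h. max 0 h ^ Suc n) \<longlongrightarrow> max 0 (0::real) ^ Suc n) (at 0)"
    by (intro tendsto_intros)
  moreover have "max 0 h ^ Suc (Suc n) / h = max 0 h ^ Suc n" for h :: real
    by (auto simp: max_def)
  ultimately show ?thesis
    using equal by (simp add: DERIV_def del: power_Suc)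
qed

text \<open>
  Integrating the term \<open>j \<ge> 1\<close> gives the term \<open>Suc j\<close> with its argument shifted by \<open>1 - \<delta>\<close>; this is where the
  delay in the Volterra equation comes from.
\<close>

definition phi_prim :: "real \<Rightarrow> real \<Rightarrow> real \<Rightarrow> nat \<Rightarrow> real" where
  "phi_prim \<delta> \<alpha> z j = (if j = 0 then z else phi_coef \<delta> \<alpha> (z + (1 - \<delta>)) (Suc j) * \<delta> / \<alpha>)"

context
  fixes \<delta> \<alpha> :: real
  assumes \<delta>: "0 < \<delta>" "\<delta> \<le> 1" and \<alpha>: "1 \<le> \<alpha>"
begin

lemma phi_base_mono: "x \<le> y \<Longrightarrow> phi_base \<delta> \<alpha> x j \<le> phi_base \<delta> \<alpha> y j"
  by (auto simp: phi_base_def)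

lemma phi_base_nonneg: "0 \<le> phi_base \<delta> \<alpha> x j"
  by (simp add: phi_base_def)

lemma phi_base_le: "j \<noteq> 0 \<Longrightarrow> phi_base \<delta> \<alpha> x j \<le> max 0 (x - tau \<delta> \<alpha>)"
proof -
  assume "j \<noteq> 0"
  then have "0 \<le> (real j - 1) * (1 - \<delta>)"
    using \<delta> by (intro mult_nonneg_nonneg) auto
  then show ?thesis
    by (simp add: phi_base_def max_def)
qed

lemma phi_coef_nonneg: "0 \<le> phi_coef \<delta> \<alpha> x j"
  using \<delta> \<alpha> by (simp add: phi_coef_def phi_base_nonneg)

lemma phi_coef_mono: "x \<le> y \<Longrightarrow> phi_coef \<delta> \<alpha> x j \<le> phi_coef \<delta> \<alpha> y j"
  unfolding phi_coef_def using \<delta> \<alpha>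
  by (intro mult_left_mono power_mono phi_base_mono phi_base_nonneg) auto

text \<open>The exponential series is a majorant for every \<open>\<delta>\<close>, including
  \<open>\<delta> = 1\<close>, where infinitely many terms may be nonzero.\<close>

lemma phi_coef_le: "phi_coef \<delta> \<alpha> x j \<le> (\<alpha> / \<delta> * max 0 (x - tau \<delta> \<alpha>)) ^ j / fact j"
proof (cases "j = 0")
  case False
  then have "phi_base \<delta> \<alpha> x j ^ j \<le> max 0 (x - tau \<delta> \<alpha>) ^ j"
    by (intro power_mono phi_base_le phi_base_nonneg)
  then have "(\<alpha> / \<delta>) ^ j / fact j * phi_base \<delta> \<alpha> x j ^ j \<le> (\<alpha> / \<delta>) ^ j / fact j * max 0 (x - tau \<delta> \<alpha>) ^ j"
    using \<delta> \<alpha> by (intro mult_left_mono) auto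
  then show ?thesis
    by (simp only: phi_coef_def power_mult_distrib) simp
qed simp

lemma summable_phi_coef: "summable (phi_coef \<delta> \<alpha> x)"
  by (rule summable_comparison_test'[OF summable_power_div_fact])
     (use phi_coef_nonneg phi_coef_le in \<open>auto simp del: times_divide_eq_left\<close>)

lemma phi1_eq_suminf: "phi1 L \<delta> \<alpha> x = L * (\<Sum>j. phi_coef \<delta> \<alpha> x j)"
proof (cases "x \<le> tau \<delta> \<alpha>")
  case True
  have "phi_coef \<delta> \<alpha> x j = 0" if "j \<noteq> 0" for j
    using phi_base_le[OF that, of x] phi_base_nonneg[of x j] True that by (simp add: phi_coef_def)
  then have "(\<Sum>j. phi_coef \<delta> \<alpha> x j) = (\<Sum>j\<in>{0}. phi_coef \<delta> \<alpha> x j)"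
    by (intro suminf_finite) auto
  with True show ?thesis by (simp add: phi1_def)
next
  case False
  have base: "phi_base \<delta> \<alpha> x j = max 0 (x - 1 + \<delta> * (1 - 1 / \<alpha>) - (real j - 1) * (1 - \<delta>))" for j
    by (simp add: phi_base_def tau_def algebra_simps)
  show ?thesis
  proof (cases "\<delta> = 1")
    case True
    have "phi_coef \<delta> \<alpha> x = phi_term \<delta> \<alpha> x"
      using False True by (intro ext) (simp add: phi_coef_def phi_term_def phi_base_def tau_def max_def)
    then show ?thesis
      using False True suminf_split_head[OF summable_phi_coef, of x]
      by (simp add: phi1_def phi_term_def[of _ _ _ 0])
  next
    case False2: False
    \<comment> \<open>\<open>y\<close> measures \<open>x - tau \<delta> \<alpha>\<close> in delays
      of length \<open>1 - \<delta>\<close>. The base of term \<open>j\<close> is nonnegative before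
      clipping exactly when \<open>real j - 1 \<le> y\<close>, and \<open>phi_N\<close> is the floor
      of \<open>y\<close> plus 1.\<close>
    define y where "y = (x - 1 + \<delta> - \<delta> / \<alpha>) / (1 - \<delta>)"
    have d: "1 - \<delta> > 0" using False2 \<delta> by simp
    have y: "y * (1 - \<delta>) = x - tau \<delta> \<alpha>"
      using d by (simp add: y_def tau_def)
    have "y > 0"
      using False d by (auto simp: y_def tau_def intro!: divide_pos_pos)
    have coef: "phi_coef \<delta> \<alpha> x j = phi_term \<delta> \<alpha> x j" if "j \<in> {1..phi_N \<delta> \<alpha> x}" for j
    proof -
      have "real j - 1 \<le> y"
        using that \<open>y > 0\<close> unfolding phi_N_def y_def[symmetric] by auto linarith
      then have "(real j - 1) * (1 - \<delta>) \<le> x - tau \<delta> \<alpha>"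
        unfolding y[symmetric] using d by (intro mult_right_mono) auto
      then have "(real j - 1) * (1 - \<delta>) \<le> x - 1 + \<delta> * (1 - 1 / \<alpha>)"
        by (simp add: tau_def algebra_simps)
      then show ?thesis
        by (simp add: phi_coef_def phi_term_def base)
    qed
    have "phi_coef \<delta> \<alpha> x j = 0" if "j > phi_N \<delta> \<alpha> x" for j
    proof -
      have "real j - 1 \<ge> y"
        using that \<open>y > 0\<close> unfolding phi_N_def y_def[symmetric] by linarith
      then have "(real j - 1) * (1 - \<delta>) \<ge> x - tau \<delta> \<alpha>"
        unfolding y[symmetric] using d by (intro mult_right_mono) auto
      then have "phi_base \<delta> \<alpha> x j = 0"
        by (simp add: phi_base_def)
      then show ?thesis
        using that by (simp add: phi_coef_def)
    qed
    then have "(\<Sum>j. phi_coef \<delta> \<alpha> x j) = (\<Sum>j\<in>{0..phi_N \<delta> \<alpha> x}. phi_coef \<delta> \<alpha> x j)"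
      by (intro suminf_finite) auto
    also have "\<dots> = 1 + (\<Sum>j = 1..phi_N \<delta> \<alpha> x. phi_coef \<delta> \<alpha> x j)"
      by (subst sum.atLeast_Suc_atMost) auto
    also have "(\<Sum>j = 1..phi_N \<delta> \<alpha> x. phi_coef \<delta> \<alpha> x j) = (\<Sum>j = 1..phi_N \<delta> \<alpha> x. phi_term \<delta> \<alpha> x j)"
      by (intro sum.cong coef) auto
    finally show ?thesis
      using False False2 by (simp add: phi1_def)
  qed
qed

text \<open>The terms are nonnegative and nondecreasing in \<open>x\<close>, so their values at
  \<open>b\<close> serve as Weierstrass majorants on the whole half-line.\<close>

lemma uniform_limit_phi_coef:
  "uniform_limit {..b} (\<lambda>n x. \<Sum>j<n. phi_coef \<delta> \<alpha> x j) (\<lambda>x. \<Sum>j. phi_coef \<delta> \<alpha> x j) sequentially"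
  by (rule Weierstrass_m_test[OF _ summable_phi_coef[of b]])
     (use phi_coef_nonneg phi_coef_mono in auto)

lemma isCont_phi1: "isCont (phi1 L \<delta> \<alpha>) x"
proof -
  have "continuous_on {..x + 1} (\<lambda>x. \<Sum>j. phi_coef \<delta> \<alpha> x j)"
    by (rule uniform_limit_theorem[OF _ uniform_limit_phi_coef])
       (auto simp: phi_coef_def phi_base_def intro!: always_eventually continuous_intros)
  then have "continuous_on {..x + 1} (phi1 L \<delta> \<alpha>)"
    by (simp add: phi1_eq_suminf[abs_def] continuous_intros)
  then have "continuous_on {..<x + 1} (phi1 L \<delta> \<alpha>)"
    by (rule continuous_on_subset) auto
  then show ?thesis
    by (subst (asm) continuous_on_eq_continuous_at) auto
qed

lemma mono_phi1: "0 < L \<Longrightarrow> mono (phi1 L \<delta> \<alpha>)"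
  by (auto simp: mono_def phi1_eq_suminf intro!: mult_left_mono suminf_le phi_coef_mono summable_phi_coef)

lemma phi1_ge: "0 < L \<Longrightarrow> L \<le> phi1 L \<delta> \<alpha> x"
  using sum_le_suminf[OF summable_phi_coef, of "{0}" x] phi_coef_nonneg
  by (simp add: phi1_eq_suminf)

lemma DERIV_phi_prim: "((\<lambda>z. phi_prim \<delta> \<alpha> z j) has_real_derivative phi_coef \<delta> \<alpha> z j) (at z)"
proof (cases j)
  case (Suc n)
  \<comment> \<open>\<open>a\<close> is the common kink of term \<open>j\<close> at \<open>z\<close>
    and of term \<open>Suc j\<close> at \<open>z + (1 - \<delta>)\<close>. Since
    \<open>j \<ge> 1\<close>, the latter has exponent at least 2.\<close>
  define a where "a = tau \<delta> \<alpha> + real n * (1 - \<delta>)"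
  have 1: "phi_prim \<delta> \<alpha> z j = (\<alpha> / \<delta>) ^ j / fact (Suc j) * max 0 (z - a) ^ Suc (Suc n)" for z
  proof -
    have *: "c ^ Suc j / F * X / c = c ^ j / F * X" if "c \<noteq> 0" for c F X :: real
      using that by simp
    have "phi_base \<delta> \<alpha> (z + (1 - \<delta>)) (Suc j) = max 0 (z - a)"
      by (simp add: Suc phi_base_def a_def algebra_simps)
    then have "phi_prim \<delta> \<alpha> z j = (\<alpha> / \<delta>) ^ Suc j / fact (Suc j) * max 0 (z - a) ^ Suc j / (\<alpha> / \<delta>)"
      by (simp add: Suc phi_prim_def phi_coef_def del: power_Suc fact_Suc)
    also have "\<dots> = (\<alpha> / \<delta>) ^ j / fact (Suc j) * max 0 (z - a) ^ Suc j"
      using \<delta> \<alpha> by (intro *) auto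
    finally show ?thesis
      unfolding Suc .
  qed
  have 2: "phi_coef \<delta> \<alpha> z j = (\<alpha> / \<delta>) ^ j / fact (Suc j) * (real (Suc (Suc n)) * max 0 (z - a) ^ Suc n)"
  proof -
    have "fact (Suc j) = real (Suc j) * fact j" by simp
    moreover have "phi_base \<delta> \<alpha> z j = max 0 (z - a)"
      by (simp add: Suc phi_base_def a_def algebra_simps)
    ultimately show ?thesis
      using Suc by (simp add: phi_coef_def del: fact_Suc of_nat_Suc power_Suc)
  qed
  show ?thesis
    unfolding 1 2 by (intro DERIV_cmult DERIV_max_0_power)
qed (auto simp: phi_prim_def[abs_def] intro!: derivative_eq_intros)

text \<open>The shifted argument \<open>1 - \<delta>\<close> lies below
  \<open>tau \<delta> \<alpha>\<close>, so the clipped bases are 0. Hence the primitive of the whole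
  series also starts at 0.\<close>

lemma phi_prim_0: "phi_prim \<delta> \<alpha> 0 j = 0"
proof (cases j)
  case (Suc n)
  have "0 \<le> real j * (1 - \<delta>)" "0 \<le> \<delta> / \<alpha>"
    using \<delta> \<alpha> by simp_all
  then have "(1 - \<delta>) - tau \<delta> \<alpha> - real j * (1 - \<delta>) \<le> 0"
    by (simp add: tau_def)
  then show ?thesis
    by (simp add: phi_prim_def phi_coef_def phi_base_def)
qed (simp add: phi_prim_def)

text \<open>Up to the factor \<open>\<delta> / \<alpha>\<close>, the primitives of index at least 1
  are the shifted series without its terms 0 and 1. Index 0 contributes \<open>z\<close> where term
  1 would have contributed \<open>max 0 (z - \<delta> / \<alpha>)\<close>; the difference of the two
  is the correction in front.\<close>

lemma phi_prim_sums:
  "phi_prim \<delta> \<alpha> z sums (z - max 0 (z - \<delta> / \<alpha>) + \<delta> / \<alpha> * ((\<Sum>j. phi_coef \<delta> \<alpha> (z + (1 - \<delta>)) j) - 1))"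
proof -
  have 1: "phi_coef \<delta> \<alpha> (z + (1 - \<delta>)) (Suc 0) = \<alpha> / \<delta> * max 0 (z - \<delta> / \<alpha>)"
    by (simp add: phi_coef_def phi_base_def tau_def)
  have "(\<lambda>j. phi_coef \<delta> \<alpha> (z + (1 - \<delta>)) (Suc (Suc j))) sums
      ((\<Sum>j. phi_coef \<delta> \<alpha> (z + (1 - \<delta>)) j) - 1 - \<alpha> / \<delta> * max 0 (z - \<delta> / \<alpha>))"
    using summable_sums[OF summable_phi_coef, of "z + (1 - \<delta>)"]
    by (subst sums_Suc_iff[of "\<lambda>j. phi_coef \<delta> \<alpha> (z + (1 - \<delta>)) (Suc j)"], subst sums_Suc_iff) (simp add: 1)
  then have "(\<lambda>j. phi_prim \<delta> \<alpha> z (Suc j)) sums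
      (((\<Sum>j. phi_coef \<delta> \<alpha> (z + (1 - \<delta>)) j) - 1 - \<alpha> / \<delta> * max 0 (z - \<delta> / \<alpha>)) * (\<delta> / \<alpha>))"
    by (drule_tac sums_mult2[where c="\<delta> / \<alpha>"]) (simp add: phi_prim_def)
  then show ?thesis
    using \<delta> \<alpha> by (subst (asm) sums_Suc_iff) (simp add: phi_prim_def algebra_simps)
qed

text \<open>This is the delayed Volterra equation with a correction: the first summand vanishes for
  \<open>\<delta> / \<alpha> \<le> z\<close>, and for smaller \<open>z\<close> it brings the value
  to \<open>L * z\<close>, the integral over the flat part.\<close>

lemma has_bochner_integral_phi1:
  assumes "0 \<le> z"
  shows "has_bochner_integral lborel (\<lambda>x. phi1 L \<delta> \<alpha> x * indicator {0..z} x)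
    (L * (z - \<delta> / \<alpha> - max 0 (z - \<delta> / \<alpha>)) + \<delta> / \<alpha> * phi1 L \<delta> \<alpha> (z + (1 - \<delta>)))"
proof -
  have "summable (phi_prim \<delta> \<alpha> 0)"
    using phi_prim_sums by (rule sums_summable)
  have "uniform_limit {..z+1} (\<lambda>n x. \<Sum>j<n. phi_coef \<delta> \<alpha> x j) (\<lambda>x. \<Sum>j. phi_coef \<delta> \<alpha> x j) sequentially"
    by (rule uniform_limit_phi_coef)
  \<comment> \<open>Termwise differentiation is done on a half-line reaching past \<open>z\<close>,
    so that every point up to \<open>z\<close> is interior and the derivative within the set becomes
    two-sided.\<close>
  then have "\<exists>g. \<forall>x\<in>{..z+1}. (phi_prim \<delta> \<alpha> x) sums g x \<and>
      (g has_real_derivative (\<Sum>j. phi_coef \<delta> \<alpha> x j)) (at x within {..z+1})"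
    by (intro has_field_derivative_series[where f="\<lambda>j x. phi_prim \<delta> \<alpha> x j" and ?x0.0=0])
       (use assms \<open>summable (phi_prim \<delta> \<alpha> 0)\<close> in \<open>auto intro!: has_field_derivative_at_within DERIV_phi_prim\<close>)
  then obtain g where g0: "\<forall>x\<in>{..z+1}. (phi_prim \<delta> \<alpha> x) sums g x \<and>
      (g has_real_derivative (\<Sum>j. phi_coef \<delta> \<alpha> x j)) (at x within {..z+1})"
    by blast
  have g: "(phi_prim \<delta> \<alpha> x) sums g x"
      "(g has_real_derivative (\<Sum>j. phi_coef \<delta> \<alpha> x j)) (at x within {..z+1})" if "x \<le> z + 1" for x
    using bspec[OF g0, of x] that by simp_all
  have D: "(g has_real_derivative (\<Sum>j. phi_coef \<delta> \<alpha> x j)) (at x)" if "x \<le> z" for x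
    using g(2)[of x] that at_within_interior[of x "{..z+1}"] by simp
  have "((\<lambda>x. L * g x) has_real_derivative phi1 L \<delta> \<alpha> x) (at x)" if "x \<le> z" for x
    unfolding phi1_eq_suminf by (intro DERIV_cmult D that)
  then have *: "has_bochner_integral lborel (\<lambda>x. phi1 L \<delta> \<alpha> x * indicator {0..z} x) (L * g z - L * g 0)"
    using assms by (intro has_bochner_integral_FTC_Icc_real isCont_phi1) blast+
  have "phi_prim \<delta> \<alpha> 0 sums 0"
    by (simp add: phi_prim_0[abs_def])
  then have "g 0 = 0"
    using sums_unique2[OF g(1)] assms by simp
  moreover have "g z = z - max 0 (z - \<delta> / \<alpha>) + \<delta> / \<alpha> * ((\<Sum>j. phi_coef \<delta> \<alpha> (z + (1 - \<delta>)) j) - 1)"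
    by (rule sums_unique2[OF g(1) phi_prim_sums]) simp
  moreover have "L * (z - m + d * (S - 1)) - L * 0 = L * (z - d - m) + d * (L * S)" for m d S :: real
    by (simp add: algebra_simps)
  ultimately have "L * g z - L * g 0 =
      L * (z - \<delta> / \<alpha> - max 0 (z - \<delta> / \<alpha>)) + \<delta> / \<alpha> * phi1 L \<delta> \<alpha> (z + (1 - \<delta>))"
    by (simp only: phi1_eq_suminf)
  with * show ?thesis by simp
qed

text \<open>Moving \<open>\<alpha> / \<delta>\<close> inside the clip leaves an expression affine in
  \<open>\<alpha>\<close>, from which monotonicity and continuity in \<open>\<alpha>\<close> are
  read off.\<close>

lemma phi_coef_at_1:
  "phi_coef \<delta> \<alpha> 1 j = max 0 (\<alpha> - 1 - (real j - 1) * ((1 - \<delta>) / \<delta>) * \<alpha>) ^ j / fact j"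
proof -
  have "\<alpha> / \<delta> * phi_base \<delta> \<alpha> 1 j = max (\<alpha> / \<delta> * 0) (\<alpha> / \<delta> * (1 - tau \<delta> \<alpha> - (real j - 1) * (1 - \<delta>)))"
    unfolding phi_base_def using \<delta> \<alpha> by (subst max_mult_distrib_left) auto
  also have "\<alpha> / \<delta> * (1 - tau \<delta> \<alpha> - (real j - 1) * (1 - \<delta>)) = \<alpha> - 1 - (real j - 1) * ((1 - \<delta>) / \<delta>) * \<alpha>"
    using \<delta> \<alpha> by (simp add: tau_def field_simps)
  finally show ?thesis
    by (simp add: phi_coef_def flip: power_mult_distrib)
qed

end

subsection \<open>The equation for the competitive ratio\<close>

lemma phi_coef_at_1_mono:
  assumes \<delta>: "0 < \<delta>" "\<delta> \<le> 1" and "1 \<le> \<alpha>" "\<alpha> \<le> \<beta>"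
  shows "phi_coef \<delta> \<alpha> 1 j \<le> phi_coef \<delta> \<beta> 1 j"
proof (cases "j = 0")
  case False
  define \<kappa> where "\<kappa> = (real j - 1) * ((1 - \<delta>) / \<delta>)"
  have "\<kappa> \<ge> 0" using False \<delta> by (simp add: \<kappa>_def)
  \<comment> \<open>The unclipped argument has slope \<open>1 - \<kappa>\<close> in
    \<open>\<alpha>\<close>. If the slope is negative, the left argument is at most -1 and is
    clipped to 0.\<close>
  have "max 0 (\<alpha> - 1 - \<kappa> * \<alpha>) \<le> max 0 (\<beta> - 1 - \<kappa> * \<beta>)"
  proof (cases "\<kappa> \<le> 1")
    case True
    then have "(1 - \<kappa>) * \<alpha> \<le> (1 - \<kappa>) * \<beta>"
      using assms by (intro mult_left_mono) auto
    then show ?thesis by (simp add: algebra_simps max_def)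
  next
    case False
    then have "\<alpha> \<le> \<kappa> * \<alpha>" using assms by simp
    then show ?thesis by (auto simp: max_def)
  qed
  then show ?thesis
    using assms unfolding \<kappa>_def by (simp add: phi_coef_at_1 divide_right_mono power_mono)
qed simp

text \<open>All terms are compared weakly; term 1 equals \<open>\<alpha> - 1\<close> and supplies
  the strictness.\<close>

lemma phi1_at_1_strict_mono:
  assumes L: "0 < L" and \<delta>: "0 < \<delta>" "\<delta> \<le> 1" and "1 \<le> \<alpha>" "\<alpha> < \<beta>"
  shows "phi1 L \<delta> \<alpha> 1 < phi1 L \<delta> \<beta> 1"
proof -
  note s = summable_phi_coef[of \<delta> _ 1, OF \<delta>]
  have a: "phi_coef \<delta> a 1 (Suc 0) = a - 1" if "a \<ge> 1" for a
    using that \<delta> by (simp add: phi_coef_at_1)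
  have "0 < (\<Sum>j. phi_coef \<delta> \<beta> 1 j - phi_coef \<delta> \<alpha> 1 j)"
    by (rule suminf_pos2[where i="Suc 0"])
       (use assms in \<open>auto simp: a intro!: summable_diff s phi_coef_at_1_mono\<close>)
  also have "\<dots> = (\<Sum>j. phi_coef \<delta> \<beta> 1 j) - (\<Sum>j. phi_coef \<delta> \<alpha> 1 j)"
    using assms by (intro suminf_diff[symmetric] s) auto
  finally show ?thesis
    using assms by (simp add: phi1_eq_suminf)
qed

lemma ex1_phi1_at_1:
  assumes L: "0 < L" and LU: "L \<le> U" and \<delta>: "0 < \<delta>" "\<delta> \<le> 1"
  shows "\<exists>!\<alpha>. \<alpha> \<ge> 1 \<and> phi1 L \<delta> \<alpha> 1 = U"
proof -
  \<comment> \<open>\<open>U / L\<close> is a valid right end for the intermediate value theorem: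
    terms 0 and 1 alone add up to \<open>A\<close>, so \<open>phi1 L \<delta> A 1\<close> is at
    least \<open>L * A = U\<close>.\<close>
  define A where "A = U / L"
  have "A \<ge> 1" using L LU by (simp add: A_def)
  note s = summable_phi_coef[of \<delta> _ 1, OF \<delta>]
  have u: "uniform_limit {1..A} (\<lambda>n a. \<Sum>j<n. phi_coef \<delta> a 1 j) (\<lambda>a. \<Sum>j. phi_coef \<delta> a 1 j) sequentially"
    by (rule Weierstrass_m_test[OF _ s[of A]])
       (use \<open>A \<ge> 1\<close> \<delta> phi_coef_nonneg phi_coef_at_1_mono in auto)
  have "continuous_on {1..A} (\<lambda>a. phi_coef \<delta> a 1 j)" for j
  proof -
    have "continuous_on {1..A} (\<lambda>a. max 0 (a - 1 - (real j - 1) * ((1 - \<delta>) / \<delta>) * a) ^ j / fact j)"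
      by (intro continuous_intros) auto
    then show ?thesis
      by (rule continuous_on_eq) (use \<delta> in \<open>auto simp: phi_coef_at_1\<close>)
  qed
  then have "continuous_on {1..A} (\<lambda>a. \<Sum>j. phi_coef \<delta> a 1 j)"
    by (intro uniform_limit_theorem[OF _ u]) (auto intro!: always_eventually continuous_intros)
  then have "continuous_on {1..A} (\<lambda>a. L * (\<Sum>j. phi_coef \<delta> a 1 j))"
    by (intro continuous_intros)
  then have c: "continuous_on {1..A} (\<lambda>a. phi1 L \<delta> a 1)"
    by (rule continuous_on_eq) (use \<delta> in \<open>auto simp: phi1_eq_suminf\<close>)
  have 1: "phi1 L \<delta> 1 1 = L"
    by (simp add: phi1_def tau_def)
  have "sum (phi_coef \<delta> A 1) {0, Suc 0} \<le> suminf (phi_coef \<delta> A 1)"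
    by (intro sum_le_suminf s) (use \<open>A \<ge> 1\<close> \<delta> phi_coef_nonneg in auto)
  then have "A \<le> suminf (phi_coef \<delta> A 1)"
    using \<open>A \<ge> 1\<close> \<delta> by (simp add: phi_coef_at_1)
  then have "L * A \<le> L * suminf (phi_coef \<delta> A 1)"
    using L by (intro mult_left_mono) auto
  then have "U \<le> phi1 L \<delta> A 1"
    using \<open>A \<ge> 1\<close> \<delta> L by (simp add: phi1_eq_suminf A_def)
  then obtain a where a: "1 \<le> a" "phi1 L \<delta> a 1 = U"
    using IVT'[of "\<lambda>a. phi1 L \<delta> a 1" 1 U A] c \<open>A \<ge> 1\<close> LU 1 by auto
  moreover have "b = a" if "1 \<le> b" "phi1 L \<delta> b 1 = U" for b
    using phi1_at_1_strict_mono[OF L \<delta>, of a b] phi1_at_1_strict_mono[OF L \<delta>, of b a] a that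
    by (cases a b rule: linorder_cases) auto
  ultimately show ?thesis by blast
qed

subsection \<open>Upper bound on the ratio\<close>

lemma welfare_ge:
  "0 \<le> p \<Longrightarrow> p * real (min s (length (filter (\<lambda>v. p \<le> v) vs))) \<le> welfare s (\<lambda>t. p) vs"
proof (induction vs arbitrary: s)
  case (Cons v vs)
  show ?case
  proof (cases "0 < s \<and> p \<le> v")
    case True
    then have "real (min s (Suc (length (filter (\<lambda>v. p \<le> v) vs)))) =
        1 + real (min (s - 1) (length (filter (\<lambda>v. p \<le> v) vs)))"
      by (cases s) auto
    then show ?thesis
      using Cons.IH[of "s - 1"] Cons.prems True by (simp add: algebra_simps)
  next
    case False
    then show ?thesis using Cons.IH[of s] Cons.prems by auto
  qed
qed simp

lemma welfare_nonneg: "(\<And>v. v \<in> set vs \<Longrightarrow> 0 \<le> v) \<Longrightarrow> 0 \<le> welfare s p vs"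
  by (induction vs arbitrary: s p) auto

lemma measurable_welfare [measurable]: "(\<lambda>p. welfare s (\<lambda>t. p) vs) \<in> borel_measurable borel"
proof (induction vs arbitrary: s)
  case (Cons v vs)
  note Cons.IH [measurable]
  show ?case by simp
qed simp

text \<open>Those of the \<open>k\<close> highest values that reach \<open>p\<close> number at most
  \<open>k\<close> and all occur in the instance, so each can be matched with a sale. The left side
  is free of the order of arrival.\<close>

lemma welfare_ge_top:
  assumes "0 \<le> p"
  shows "(\<Sum>v\<leftarrow>take k (rev (sort vs)). if p \<le> v then p else 0) \<le> welfare k (\<lambda>t. p) vs"
proof -
  let ?ys = "take k (rev (sort vs))"
  have "mset (filter (\<lambda>v. p \<le> v) (rev (sort vs))) = mset (filter (\<lambda>v. p \<le> v) vs)"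
    by simp
  then have len: "length (filter (\<lambda>v. p \<le> v) (rev (sort vs))) = length (filter (\<lambda>v. p \<le> v) vs)"
    by (rule mset_eq_length)
  have "length (filter (\<lambda>v. p \<le> v) (rev (sort vs))) =
      length (filter (\<lambda>v. p \<le> v) ?ys) + length (filter (\<lambda>v. p \<le> v) (drop k (rev (sort vs))))"
    by (metis append_take_drop_id filter_append length_append)
  moreover have "length (filter (\<lambda>v. p \<le> v) ?ys) \<le> k"
    using length_filter_le[of "\<lambda>v. p \<le> v" ?ys] by simp
  ultimately have "length (filter (\<lambda>v. p \<le> v) ?ys) \<le> min k (length (filter (\<lambda>v. p \<le> v) vs))"
    unfolding len[symmetric] by simp
  then have "p * real (length (filter (\<lambda>v. p \<le> v) ?ys)) \<le> welfare k (\<lambda>t. p) vs"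
    using welfare_ge[OF assms, of k vs] assms by (meson mult_left_mono of_nat_mono order_trans)
  moreover have "(\<Sum>v\<leftarrow>ys. if p \<le> v then p else 0) = p * real (length (filter (\<lambda>v. p \<le> v) ys))" for ys
    by (induction ys) (auto simp: algebra_simps)
  ultimately show ?thesis by simp
qed

lemma cvar_ge: "ereal (\<tau> - 1 / \<delta> * (\<integral>\<omega>. max (\<tau> - X \<omega>) 0 \<partial>M)) \<le> cvar \<delta> M X"
  unfolding cvar_def by (rule SUP_upper) simp

lemma opt_pos:
  assumes "0 < L" "vs \<in> instances L U" "k \<ge> 1"
  shows "0 < opt k vs"
proof -
  obtain y ys where y: "rev (sort vs) = y # ys"
    using assms by (cases "rev (sort vs)") (auto simp: instances_def dest: arg_cong[where f=length])
  have s: "set (rev (sort vs)) \<subseteq> {L..U}"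
    using assms by (simp add: instances_def)
  have "set (take (k - 1) ys) \<subseteq> {L..U}"
    using s set_take_subset[of "k - 1" ys] unfolding y by auto
  then have "0 \<le> sum_list (take (k - 1) ys)"
    using assms by (intro sum_list_nonneg) auto
  moreover have "0 < y"
    using s assms unfolding y by auto
  ultimately show ?thesis
    using assms by (cases k) (simp_all add: opt_def y)
qed

lemma integral_cPPM_static:
  fixes f :: "real \<Rightarrow> real"
  assumes [measurable]: "\<phi> \<in> borel_measurable borel" "f \<in> borel_measurable borel"
  shows "integral\<^sup>L (cPPM_static \<phi>) f = (\<integral>x. indicator {0..1} x * f (\<phi> x) \<partial>lborel)"
proof -
  have "integral\<^sup>L (cPPM_static \<phi>) f = (\<integral>x. f (\<phi> x) \<partial>uniform_measure lborel {0..1})"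
    unfolding cPPM_static_def by (subst integral_distr) auto
  also have "uniform_measure lborel {0..1} = density lborel (\<lambda>x. ennreal (indicator {0..1::real} x))"
    by (simp add: uniform_measure_def ennreal_indicator divide_ennreal_def)
  also have "(\<integral>x. f (\<phi> x) \<partial>\<dots>) = (\<integral>x. indicator {0..1} x * f (\<phi> x) \<partial>lborel)"
    by (subst integral_density) auto
  finally show ?thesis .
qed

lemma static_scheme_cPPM_static:
  "\<phi> \<in> borel_measurable borel \<Longrightarrow> static_scheme (cPPM_static \<phi>)"
  unfolding static_scheme_def cPPM_static_def
  by (auto intro!: prob_space.prob_space_distr prob_space_uniform_measure)

text \<open>Superadditivity of CVaR is made explicit: the thresholds \<open>s v\<close> of the
  individual values add up to the threshold for the welfare, and the shortfall of a sum is at most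
  the sum of the shortfalls.\<close>

lemma static_cvar_cPPM_ge:
  assumes L: "0 < L" and \<delta>: "0 < \<delta>" "\<delta> \<le> 1" and \<alpha>: "1 \<le> \<alpha>" and U: "phi1 L \<delta> \<alpha> 1 = U"
    and vs: "vs \<in> instances L U"
  shows "ereal (opt k vs / \<alpha>) \<le> static_cvar k \<delta> (cPPM_static (phi1 L \<delta> \<alpha>)) vs"
proof -
  define \<phi> where "\<phi> = phi1 L \<delta> \<alpha>"
  have mono: "mono \<phi>"
    unfolding \<phi>_def by (rule mono_phi1[OF \<delta> \<alpha> L])
  then have [measurable]: "\<phi> \<in> borel_measurable borel"
    by (rule borel_measurable_mono)
  have \<phi>_ge: "L \<le> \<phi> x" for x
    unfolding \<phi>_def by (rule phi1_ge[OF \<delta> \<alpha> L])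
  define ys where "ys = take k (rev (sort vs))"
  have ys: "v \<in> {L..U}" if "v \<in> set ys" for v
    using that vs set_take_subset[of k "rev (sort vs)"] by (auto simp: ys_def instances_def)
  have tau: "tau \<delta> \<alpha> \<le> 1" "\<delta> / \<alpha> > 0" "\<phi> (tau \<delta> \<alpha>) = L"
    using \<delta> \<alpha> by (simp_all add: tau_def \<phi>_def phi1_def field_simps)
  \<comment> \<open>Searching only from \<open>tau \<delta> \<alpha>\<close> on ensures
    \<open>\<delta> / \<alpha> \<le> z v\<close> below, where the correction term of the Volterra
    equation vanishes.\<close>
  have "\<exists>x. tau \<delta> \<alpha> \<le> x \<and> x \<le> 1 \<and> \<phi> x = v" if "v \<in> {L..U}" for v
    using that tau U isCont_phi1[OF \<delta> \<alpha>] by (intro IVT) (auto simp: \<phi>_def)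
  then obtain X where X: "\<And>v. v \<in> {L..U} \<Longrightarrow> tau \<delta> \<alpha> \<le> X v \<and> X v \<le> 1 \<and> \<phi> (X v) = v"
    by metis
  \<comment> \<open>\<open>s v\<close> is the price below which the cheapest accepted prices, of total probability \<open>\<delta> - (1 - X v)\<close>, lie;
    the other \<open>1 - X v\<close> of the worst \<open>\<delta>\<close> outcomes are rejections.\<close>
  define z where "z v = X v - (1 - \<delta>)" for v
  define s where "s v = \<phi> (z v)" for v
  define h where "h v r = max (s v - (if \<phi> r \<le> v then \<phi> r else 0)) 0" for v r
  \<comment> \<open>Majorant of \<open>h v\<close> on the unit interval, with an integral that the
    Volterra equation evaluates. Seeds from \<open>X v\<close> on are charged the full
    \<open>s v\<close>, rejected or not.\<close>
  define g where "g v r = s v * indicator {0..z v} r - \<phi> r * indicator {0..z v} r + s v * indicator {X v..1} r" for v r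
  have g_int: "has_bochner_integral lborel (g v) (\<delta> * s v - \<delta> / \<alpha> * v)" if "v \<in> {L..U}" for v
  proof -
    have z: "z v \<ge> \<delta> / \<alpha>" using X[OF that] by (simp add: z_def tau_def)
    then have "0 \<le> z v" using tau by simp
    have "has_bochner_integral lborel (\<lambda>x. \<phi> x * indicator {0..z v} x) (\<delta> / \<alpha> * \<phi> (X v))"
      using has_bochner_integral_phi1[OF \<delta> \<alpha> \<open>0 \<le> z v\<close>, of L] z by (simp add: \<phi>_def z_def)
    moreover have "has_bochner_integral lborel (\<lambda>x. s v * indicator {0..z v} x) (s v * z v)"
      using \<open>0 \<le> z v\<close> by (intro has_bochner_integral_mult_right) (auto simp: has_bochner_integral_iff)
    moreover have "has_bochner_integral lborel (\<lambda>x. s v * indicator {X v..1} x) (s v * (1 - X v))"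
      using X[OF that] by (intro has_bochner_integral_mult_right) (auto simp: has_bochner_integral_iff)
    ultimately have "has_bochner_integral lborel (g v) (s v * z v - \<delta> / \<alpha> * \<phi> (X v) + s v * (1 - X v))"
      unfolding g_def by (intro has_bochner_integral_add has_bochner_integral_diff)
    also have "s v * z v - \<delta> / \<alpha> * \<phi> (X v) + s v * (1 - X v) = \<delta> * s v - \<delta> / \<alpha> * v"
      using X[OF that] by (simp add: z_def algebra_simps)
    finally show ?thesis .
  qed
  have hg: "indicator {0..1} r * h v r \<le> g v r" if "v \<in> {L..U}" for v r
  proof (cases "r \<in> {0..1}")
    case True
    have "0 < \<phi> r" "0 < s v" using \<phi>_ge[of r] \<phi>_ge[of "z v"] L by (auto simp: s_def)
    have "z v \<le> X v" using \<delta> by (simp add: z_def)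
    consider "r \<le> z v" "r < X v" | "z v < r" "r < X v" | "r \<ge> X v" by linarith
    then show ?thesis
    proof cases
      case 1
      then have "\<phi> r \<le> s v" "\<phi> r \<le> v"
        using mono X[OF that] monoD[of \<phi> r "z v"] monoD[of \<phi> r "X v"] by (auto simp: s_def)
      then show ?thesis using True 1 by (simp add: h_def g_def)
    next
      case 2
      then have "s v \<le> \<phi> r" "\<phi> r \<le> v"
        using mono X[OF that] monoD[of \<phi> "z v" r] monoD[of \<phi> r "X v"] by (auto simp: s_def)
      then show ?thesis using True 2 by (simp add: h_def g_def)
    next
      case 3
      have "h v r \<le> s v" using \<open>0 < \<phi> r\<close> \<open>0 < s v\<close> by (simp add: h_def)
      \<comment> \<open>Here \<open>r \<le> z v\<close> forces \<open>\<delta> = 1\<close> and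
        \<open>r = X v\<close>, the one point where the two intervals of \<open>g v\<close>
        overlap.\<close>
      moreover have "\<phi> r \<le> s v" if "r \<le> z v" using that mono by (auto simp: s_def dest: monoD)
      ultimately show ?thesis using True 3 by (auto simp: g_def indicator_def)
    qed
  next
    case False
    have "s v \<ge> \<phi> r" if "r \<le> z v" using that mono by (auto simp: s_def dest: monoD)
    moreover have "0 < s v" using \<phi>_ge[of "z v"] L by (auto simp: s_def)
    ultimately show ?thesis using False by (auto simp: g_def indicator_def)
  qed
  define n where "n = length ys"
  have nth: "ys ! i \<in> {L..U}" if "i < n" for i
    using that ys nth_mem by (auto simp: n_def)
  define \<tau> where "\<tau> = (\<Sum>i<n. s (ys ! i))"
  have X_ge: "(\<Sum>i<n. if \<phi> r \<le> ys ! i then \<phi> r else 0) \<le> welfare k (\<lambda>t. \<phi> r) vs" for r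
    using welfare_ge_top[of "\<phi> r" k vs] \<phi>_ge[of r] L
    by (simp add: sum_list_sum_nth ys_def n_def atLeast0LessThan)
  have le_h: "max (\<tau> - welfare k (\<lambda>t. \<phi> r) vs) 0 \<le> (\<Sum>i<n. h (ys ! i) r)" for r
  proof -
    have "\<tau> - welfare k (\<lambda>t. \<phi> r) vs \<le> (\<Sum>i<n. s (ys ! i) - (if \<phi> r \<le> ys ! i then \<phi> r else 0))"
      using X_ge[of r] by (simp add: \<tau>_def sum_subtractf)
    also have "\<dots> \<le> (\<Sum>i<n. h (ys ! i) r)"
      by (intro sum_mono) (simp add: h_def)
    finally show ?thesis
      by (simp add: sum_nonneg h_def)
  qed
  have G: "has_bochner_integral lborel (\<lambda>r. \<Sum>i<n. g (ys ! i) r) (\<Sum>i<n. \<delta> * s (ys ! i) - \<delta> / \<alpha> * ys ! i)"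
    by (intro has_bochner_integral_sum g_int nth) simp
  have "(\<integral>r. indicator {0..1} r * max (\<tau> - welfare k (\<lambda>t. \<phi> r) vs) 0 \<partial>lborel) \<le> (\<integral>r. (\<Sum>i<n. g (ys ! i) r) \<partial>lborel)"
  proof (rule integral_mono')
    show le: "indicator {0..1} r * max (\<tau> - welfare k (\<lambda>t. \<phi> r) vs) 0 \<le> (\<Sum>i<n. g (ys ! i) r)" for r
    proof -
      have "indicator {0..1} r * max (\<tau> - welfare k (\<lambda>t. \<phi> r) vs) 0 \<le> indicator {0..1} r * (\<Sum>i<n. h (ys ! i) r)"
        by (intro mult_left_mono le_h) auto
      also have "\<dots> \<le> (\<Sum>i<n. g (ys ! i) r)"
        unfolding sum_distrib_left by (intro sum_mono hg nth) simp
      finally show ?thesis .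
    qed
    show "0 \<le> (\<Sum>i<n. g (ys ! i) r)" for r
      by (rule order_trans[OF _ le]) (simp add: indicator_def)
  qed (use G in \<open>simp add: has_bochner_integral_iff\<close>)
  also have "\<dots> = (\<Sum>i<n. \<delta> * s (ys ! i) - \<delta> / \<alpha> * ys ! i)"
    using G by (simp add: has_bochner_integral_iff)
  also have "\<dots> = \<delta> * (\<tau> - opt k vs / \<alpha>)"
    by (simp add: opt_def sum_list_sum_nth ys_def[symmetric] n_def[symmetric] atLeast0LessThan \<tau>_def
        sum_subtractf sum_distrib_left right_diff_distrib sum_divide_distrib)
  finally have "(\<integral>P. max (\<tau> - welfare k (\<lambda>t. P) vs) 0 \<partial>cPPM_static \<phi>) \<le> \<delta> * (\<tau> - opt k vs / \<alpha>)"
    by (subst integral_cPPM_static) auto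
  then have "opt k vs / \<alpha> \<le> \<tau> - 1 / \<delta> * (\<integral>P. max (\<tau> - welfare k (\<lambda>t. P) vs) 0 \<partial>cPPM_static \<phi>)"
    using \<delta> by (simp add: field_simps)
  then show ?thesis
    using cvar_ge[of \<tau> \<delta> "cPPM_static \<phi>" "\<lambda>P. welfare k (\<lambda>t. P) vs"]
    unfolding static_cvar_def \<phi>_def[symmetric] by (meson ereal_less_eq(3) order_trans)
qed

lemma static_cvar_cr_cPPM_le:
  assumes L: "0 < L" and \<delta>: "0 < \<delta>" "\<delta> \<le> 1" and \<alpha>: "1 \<le> \<alpha>" and U: "phi1 L \<delta> \<alpha> 1 = U"
    and k: "k \<ge> 1"
  shows "static_cvar_cr L U k \<delta> (cPPM_static (phi1 L \<delta> \<alpha>)) \<le> ereal \<alpha>"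
  unfolding static_cvar_cr_def
proof (rule SUP_least)
  fix vs assume vs: "vs \<in> instances L U"
  define C where "C = static_cvar k \<delta> (cPPM_static (phi1 L \<delta> \<alpha>)) vs"
  have C: "ereal (opt k vs / \<alpha>) \<le> C"
    unfolding C_def by (rule static_cvar_cPPM_ge[OF assms(1-5) vs])
  have "0 < opt k vs" by (rule opt_pos[OF L vs k])
  then have "0 < opt k vs / \<alpha>" using \<alpha> by simp
  have "ereal (opt k vs) / C \<le> ereal \<alpha> \<and> C \<noteq> 0"
  proof (cases C)
    case (real c)
    have "opt k vs / \<alpha> \<le> c" using C real by simp
    then have "0 < c"
      using \<open>0 < opt k vs / \<alpha>\<close> by linarith
    then have "opt k vs / c \<le> \<alpha>"
      using \<open>opt k vs / \<alpha> \<le> c\<close> \<alpha> by (simp add: field_simps)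
    then show ?thesis
      using real \<open>0 < c\<close> by simp
  next
    case PInf
    then show ?thesis using \<alpha> by simp
  next
    case MInf
    then show ?thesis using C by simp
  qed
  then show "(if C = 0 then \<infinity> else ereal (opt k vs) / C) \<le> ereal \<alpha>"
    by simp
qed

subsection \<open>Lower bound on the ratio\<close>

lemma welfare_0 [simp]: "welfare 0 p vs = 0"
  by (induction vs arbitrary: p) auto

lemma welfare_replicate_buy:
  "p \<le> u \<Longrightarrow> m \<le> s \<Longrightarrow>
    welfare s (\<lambda>t. p) (replicate m u @ vs) = real m * u + welfare (s - m) (\<lambda>t. p) vs"
  by (induction m arbitrary: s) (auto simp: algebra_simps)

lemma welfare_replicate_decline:
  "u < p \<Longrightarrow> welfare s (\<lambda>t. p) (replicate m u @ vs) = welfare s (\<lambda>t. p) vs"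
  by (induction m) auto

text \<open>The first block whose value reaches the price takes all \<open>k\<close> units, so at
  most one block is ever served.\<close>

lemma welfare_blocks:
  "welfare k (\<lambda>t. p) (concat (map (replicate k) us)) =
    (case find (\<lambda>u. p \<le> u) us of None \<Rightarrow> 0 | Some u \<Rightarrow> real k * u)"
  by (induction us) (auto simp: welfare_replicate_buy welfare_replicate_decline)

lemma sorted_blocks: "sorted us \<Longrightarrow> sorted (concat (map (replicate k) us))"
  by (induction us) (auto simp: sorted_append sorted_replicate)

lemma opt_blocks:
  assumes "sorted (us @ [v])"
  shows "opt k (concat (map (replicate k) (us @ [v]))) = real k * v"
proof -
  have "sort (concat (map (replicate k) (us @ [v]))) = concat (map (replicate k) us) @ replicate k v"
    using sorted_sort_id[OF sorted_blocks[OF assms]] by simp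
  then show ?thesis
    by (simp add: opt_def sum_list_replicate)
qed

text \<open>A price between \<open>L\<close> and \<open>v\<close> sells out at the first grid value
  not below it, which exceeds it by at most one mesh width. That is the source of
  \<open>\<epsilon>\<close>.\<close>

lemma ascending_instance:
  assumes "0 < L" "L \<le> v" "v \<le> U" "k \<ge> 1" "0 < \<epsilon>"
  obtains vs where "vs \<in> instances L U" "opt k vs = real k * v"
    "\<And>p. welfare k (\<lambda>t. p) vs \<le> real k * (max L p + \<epsilon>)"
    "\<And>p. v < p \<Longrightarrow> welfare k (\<lambda>t. p) vs = 0"
proof -
  \<comment> \<open>The count \<open>n\<close> makes the mesh \<open>e\<close> at most
    \<open>\<epsilon>\<close>. For \<open>v = L\<close> the mesh is 0 and all blocks
    coincide.\<close>
  obtain n where n: "(v - L) / \<epsilon> < real n"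
    using reals_Archimedean2 by blast
  moreover have "0 \<le> (v - L) / \<epsilon>" using assms by simp
  ultimately have "real n > 0" by linarith
  then have n0: "n > 0" by simp
  define e where "e = (v - L) / real n"
  have e: "0 \<le> e" "e \<le> \<epsilon>" "e * real n = v - L"
    using assms n n0 by (auto simp: e_def field_simps)
  define u where "u i = L + e * real i" for i
  have u_mono: "u i \<le> u j" if "i \<le> j" for i j
    using that e by (auto simp: u_def intro!: mult_left_mono)
  have u_n: "u n = v" using e by (simp add: u_def)
  define us where "us = map u [0..<Suc n]"
  have us: "us = map u [0..<n] @ [v]" by (simp add: us_def u_n)
  have "sorted us"
    unfolding us_def by (rule sorted_map_mono[OF sorted_upt]) (auto simp: mono_on_def u_mono)
  define vs where "vs = concat (map (replicate k) us)"
  have set_us: "set us \<subseteq> {L..v}"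
    using u_mono[of 0] u_mono[of _ n] by (auto simp: us_def u_n u_def[of 0] simp del: upt_Suc)
  have "set vs \<subseteq> set us" by (auto simp: vs_def)
  then have "set vs \<subseteq> {L..U}" using set_us assms by force
  moreover have "vs \<noteq> []" using assms by (auto simp: vs_def us)
  ultimately have "vs \<in> instances L U" by (simp add: instances_def)
  moreover have "opt k vs = real k * v"
    using opt_blocks[of "map u [0..<n]" v k] \<open>sorted us\<close> by (simp add: vs_def us)
  moreover have "welfare k (\<lambda>t. p) vs \<le> real k * (max L p + \<epsilon>)" for p
  proof (cases "find (\<lambda>u. p \<le> u) us")
    case None
    have "0 \<le> max L p + \<epsilon>" using assms by simp
    with None show ?thesis by (simp add: vs_def welfare_blocks)
  next
    case (Some w)
    then obtain i where i: "i < Suc n" "w = u i" "\<And>j. j < i \<Longrightarrow> u j < p"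
      by (auto simp: find_Some_iff us_def not_le simp del: upt_Suc)
    \<comment> \<open>By minimality of \<open>i\<close>, the preceding grid value is below
      \<open>p\<close>; for \<open>i = 0\<close> there is none and \<open>w = L\<close>.\<close>
    have "w \<le> max L p + \<epsilon>"
    proof (cases i)
      case 0
      then show ?thesis using i(2) assms by (simp add: u_def)
    next
      case (Suc j)
      then show ?thesis using i(2) i(3)[of j] e by (simp add: u_def algebra_simps)
    qed
    with Some show ?thesis by (simp add: vs_def welfare_blocks mult_left_mono)
  qed
  moreover have "welfare k (\<lambda>t. p) vs = 0" if "v < p" for p
  proof -
    have "find (\<lambda>u. p \<le> u) us = None"
      using set_us that by (force simp: find_None_iff)
    then show ?thesis by (simp add: vs_def welfare_blocks)
  qed
  ultimately show ?thesis by (rule that)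
qed

section \<open>Quantile function and seed representation of a scheme\<close>

definition quantile :: "real measure \<Rightarrow> real \<Rightarrow> real" where
  "quantile D r = (if r \<in> {0<..<1} then Inf {x. r \<le> cdf D x} else 0)"

lemma static_scheme_cdf_distribution: "static_scheme D \<Longrightarrow> cdf_distribution D"
  by (simp add: static_scheme_def cdf_distribution_def real_distribution_def real_distribution_axioms_def)

text \<open>The \<open>cdf\<close> is right-continuous, so the infimum defining the quantile is
  attained; this is the Galois connection between the two functions.\<close>

lemma quantile_le_iff:
  assumes "static_scheme D" "0 < r" "r < 1"
  shows "quantile D r \<le> x \<longleftrightarrow> r \<le> cdf D x"
proof -
  interpret cdf_distribution D by (rule static_scheme_cdf_distribution[OF assms(1)])
  show ?thesis using pseudoinverse[of r x] assms by (simp add: quantile_def)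
qed

lemma cdf_static_scheme_le_1: "static_scheme D \<Longrightarrow> cdf D x \<le> 1"
  unfolding static_scheme_def cdf_def by (simp add: prob_space.prob_le_1)

lemma measurable_quantile:
  assumes "static_scheme D"
  shows "quantile D \<in> borel_measurable borel"
proof -
  interpret cdf_distribution D by (rule static_scheme_cdf_distribution[OF assms(1)])
  have "(\<lambda>r. if r \<in> {0<..<1} then Inf {x. r \<le> cdf D x} else 0) \<in> borel_measurable borel"
  proof (subst measurable_If_restrict_space_iff)
    have "{x \<in> space borel. x \<in> {0<..<1}} = {0<..<1::real}" by auto
    then show "I \<in> borel_measurable (restrict_space borel {x. x \<in> {0<..<1}}) \<and>
        (\<lambda>x. 0) \<in> borel_measurable (restrict_space borel {x. x \<notin> {0<..<1}})"
      using measurable_CI by simp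
  qed auto
  then show ?thesis by (simp add: quantile_def[abs_def])
qed

text \<open>Inverse transform sampling: the quantile of a uniform seed has distribution
  \<open>D\<close>. Arbitrary schemes thus become functions of a seed, as in cPPM.\<close>

lemma integral_static_scheme:
  fixes f :: "real \<Rightarrow> real"
  assumes "static_scheme D" and f: "f \<in> borel_measurable borel"
  shows "integral\<^sup>L D f = (\<integral>r. indicator {0<..<1} r * f (quantile D r) \<partial>lborel)"
proof -
  interpret cdf_distribution D by (rule static_scheme_cdf_distribution[OF assms(1)])
  have [measurable]: "I \<in> borel_measurable (restrict_space lborel {0<..<1})"
    using measurable_CI by (simp cong: measurable_cong_sets sets_restrict_space_cong)
  have "integral\<^sup>L D f = integral\<^sup>L (distr (restrict_space lborel {0<..<1}) borel I) f"
    by (simp add: distr_I_eq_M)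
  also have "\<dots> = (\<integral>r. f (I r) \<partial>restrict_space lborel {0<..<1})"
    using f by (subst integral_distr) auto
  also have "\<dots> = (\<integral>r. indicator {0<..<1} r * f (quantile D r) \<partial>lborel)"
    by (subst integral_restrict_space) (auto intro!: Bochner_Integration.integral_cong simp: quantile_def indicator_def)
  finally show ?thesis .
qed

lemma integrable_indicator_Ioo_bounded:
  fixes f :: "real \<Rightarrow> real"
  assumes [measurable]: "f \<in> borel_measurable borel" and "\<And>r. r \<in> {a<..<b} \<Longrightarrow> \<bar>f r\<bar> \<le> B"
  shows "integrable lborel (\<lambda>r. indicator {a<..<b} r * f r)"
proof (rule integrableI_bounded_set[where A="{a<..<b}" and B=B])
  show "emeasure lborel {a<..<b} < \<infinity>"
    by (cases "a \<le> b") auto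
qed (use assms in auto)

text \<open>Seeds above \<open>cdf D v\<close> earn 0. If their mass is below
  \<open>\<delta>\<close>, the worst outcomes are completed by a further mass
  \<open>cdf D v - (1 - \<delta>)\<close>; taking it from the lowest seeds, whether or not they are
  the worst, can only overestimate CVaR.\<close>

lemma cvar_le_quantile_integral:
  assumes D: "static_scheme D" and \<delta>: "0 < \<delta>" "\<delta> \<le> 1"
    and X [measurable]: "X \<in> borel_measurable borel" and X0: "\<And>p. 0 \<le> X p" and XB: "\<And>p. X p \<le> B"
    and Xv: "\<And>p. v < p \<Longrightarrow> X p = 0"
  shows "cvar \<delta> D X \<le> ereal (1 / \<delta> * (\<integral>r. indicator {0<..<cdf D v - (1 - \<delta>)} r * X (quantile D r) \<partial>lborel))"
  unfolding cvar_def
proof (rule SUP_least)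
  fix \<tau> :: real
  define c where "c = cdf D v - (1 - \<delta>)"
  note measurable_quantile[OF D, measurable]
  have c: "c \<le> cdf D v" "cdf D v \<le> 1"
    using cdf_static_scheme_le_1[OF D] \<delta> by (simp_all add: c_def)
  have "0 \<le> cdf D v" by (simp add: cdf_def)
  have zero: "X (quantile D r) = 0" if "cdf D v < r" "r < 1" for r
    using Xv quantile_le_iff[OF D, of r v] that \<open>0 \<le> cdf D v\<close> by force
  have EX: "(\<integral>\<omega>. max (\<tau> - X \<omega>) 0 \<partial>D) = (\<integral>r. indicator {0<..<1} r * max (\<tau> - X (quantile D r)) 0 \<partial>lborel)"
    by (rule integral_static_scheme[OF D]) simp
  have bound: "\<bar>max (\<tau> - X p) 0\<bar> \<le> \<bar>\<tau>\<bar> + B" for p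
    using X0[of p] XB[of p] by linarith
  have int1: "integrable lborel (\<lambda>r. indicator {0<..<1} r * max (\<tau> - X (quantile D r)) 0)"
    by (rule integrable_indicator_Ioo_bounded[where B="\<bar>\<tau>\<bar> + B"]) (simp, rule bound)
  have int2: "integrable lborel (\<lambda>r. indicator {0<..<c} r * X (quantile D r))"
    by (rule integrable_indicator_Ioo_bounded[where B=B]) (use X0 XB in auto)
  have I_nonneg: "0 \<le> (\<integral>r. indicator {0<..<c} r * X (quantile D r) \<partial>lborel)"
    by (intro Bochner_Integration.integral_nonneg) (auto simp: X0)
  have "\<delta> * \<tau> - (\<integral>r. indicator {0<..<c} r * X (quantile D r) \<partial>lborel) \<le> (\<integral>\<omega>. max (\<tau> - X \<omega>) 0 \<partial>D)"
  \<comment> \<open>For \<open>0 < c\<close> the shortfall is bounded below on the seeds in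
    \<open>{0<..<c}\<close> and above \<open>cdf D v\<close>, of total mass \<open>\<delta>\<close>.
    For \<open>c \<le> 0\<close> the zero tail alone has mass at least \<open>\<delta>\<close>,
    enough if \<open>0 \<le> \<tau>\<close>; a negative \<open>\<tau>\<close> is then trivial, as
    the shortfall is nonnegative.\<close>
  proof (cases "0 < c \<or> \<tau> < 0")
    case True
    show ?thesis
    proof (cases "0 < c")
      case True
      have tail: "has_bochner_integral lborel (\<lambda>r. \<tau> * indicator {cdf D v<..<1} r) (\<tau> * (1 - cdf D v))"
        using c by (intro has_bochner_integral_mult_right) (auto simp: has_bochner_integral_iff)
      have head: "has_bochner_integral lborel (\<lambda>r. \<tau> * indicator {0<..<c} r) (\<tau> * c)"
        using True by (intro has_bochner_integral_mult_right) (auto simp: has_bochner_integral_iff)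
      have "has_bochner_integral lborel
          (\<lambda>r. \<tau> * indicator {0<..<c} r + \<tau> * indicator {cdf D v<..<1} r - indicator {0<..<c} r * X (quantile D r))
          (\<tau> * c + \<tau> * (1 - cdf D v) - (\<integral>r. indicator {0<..<c} r * X (quantile D r) \<partial>lborel))"
        using int2 by (intro has_bochner_integral_add has_bochner_integral_diff head tail) (simp add: has_bochner_integral_iff)
      moreover have "\<tau> * c + \<tau> * (1 - cdf D v) = \<delta> * \<tau>"
        by (simp add: c_def algebra_simps)
      moreover have "(\<integral>r. \<tau> * indicator {0<..<c} r + \<tau> * indicator {cdf D v<..<1} r - indicator {0<..<c} r * X (quantile D r) \<partial>lborel)
         \<le> (\<integral>\<omega>. max (\<tau> - X \<omega>) 0 \<partial>D)"
        unfolding EX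
      proof (rule integral_mono[OF _ int1])
        show "\<tau> * indicator {0<..<c} r + \<tau> * indicator {cdf D v<..<1} r - indicator {0<..<c} r * X (quantile D r)
            \<le> indicator {0<..<1} r * max (\<tau> - X (quantile D r)) 0" for r
          using c zero[of r] True by (auto simp: indicator_def)
      qed (use calculation(1) in \<open>simp add: has_bochner_integral_iff\<close>)
      ultimately show ?thesis by (simp add: has_bochner_integral_iff)
    next
      case False
      then have "\<delta> * \<tau> \<le> 0" using True \<delta> by (simp add: mult_nonneg_nonpos)
      moreover have "0 \<le> (\<integral>\<omega>. max (\<tau> - X \<omega>) 0 \<partial>D)" by (intro Bochner_Integration.integral_nonneg) simp
      ultimately show ?thesis using I_nonneg by linarith
    qed
  next
    case False
    have tail: "has_bochner_integral lborel (\<lambda>r. \<tau> * indicator {cdf D v<..<1} r) (\<tau> * (1 - cdf D v))"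
      using c by (intro has_bochner_integral_mult_right) (auto simp: has_bochner_integral_iff)
    have "\<delta> * \<tau> \<le> \<tau> * (1 - cdf D v)"
      using False by (subst mult.commute, intro mult_left_mono) (auto simp: c_def)
    also have "\<dots> \<le> (\<integral>\<omega>. max (\<tau> - X \<omega>) 0 \<partial>D)"
      unfolding EX has_bochner_integral_integral_eq[OF tail, symmetric]
    proof (rule integral_mono[OF _ int1])
      show "\<tau> * indicator {cdf D v<..<1} r \<le> indicator {0<..<1} r * max (\<tau> - X (quantile D r)) 0" for r
        using c zero[of r] False \<open>0 \<le> cdf D v\<close> by (auto simp: indicator_def)
    qed (use tail in \<open>simp add: has_bochner_integral_iff\<close>)
    finally show ?thesis using I_nonneg by linarith
  qed
  moreover have "t - 1 / \<delta> * e \<le> 1 / \<delta> * j" if "\<delta> * t - j \<le> e" for t j e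
    using mult_left_mono[OF that, of "1 / \<delta>"] \<delta> by (simp add: right_diff_distrib)
  ultimately have "\<tau> - 1 / \<delta> * (\<integral>\<omega>. max (\<tau> - X \<omega>) 0 \<partial>D) \<le>
      1 / \<delta> * (\<integral>r. indicator {0<..<c} r * X (quantile D r) \<partial>lborel)"
    by blast
  then show "ereal (\<tau> - 1 / \<delta> * (\<integral>\<omega>. max (\<tau> - X \<omega>) 0 \<partial>D)) \<le>
      ereal (1 / \<delta> * (\<integral>r. indicator {0<..<cdf D v - (1 - \<delta>)} r * X (quantile D r) \<partial>lborel))"
    by (simp add: c_def)
qed

text \<open>A Gronwall-type comparison: set against the Volterra equation for \<open>phi1\<close>,
  the inequality bounds the excess of \<open>\<Psi>\<close> by an integral of the excess over
  earlier seeds. It is demanded only where \<open>L < \<Psi> x\<close>, since \<open>phi1\<close> is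
  at least \<open>L\<close> everywhere.\<close>

lemma phi1_comparison:
  fixes \<Psi> :: "real \<Rightarrow> real"
  assumes L: "0 < L" and \<delta>: "0 < \<delta>" "\<delta> \<le> 1" and \<beta>: "1 \<le> \<beta>"
    and [measurable]: "\<Psi> \<in> borel_measurable borel" and \<Psi>: "\<And>x. L \<le> \<Psi> x" "\<And>x. \<Psi> x \<le> U"
    and sub: "\<And>x. 0 < x \<Longrightarrow> x < 1 \<Longrightarrow> L < \<Psi> x \<Longrightarrow>
      \<Psi> x \<le> \<beta> / \<delta> * (\<integral>r. indicator {0<..<x - (1 - \<delta>)} r * \<Psi> r \<partial>lborel)"
    and x: "0 < x" "x < 1"
  shows "\<Psi> x \<le> phi1 L \<delta> \<beta> x"
proof -
  define \<phi> where "\<phi> = phi1 L \<delta> \<beta>"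
  define c where "c = \<beta> / \<delta>"
  have "c > 0" using \<delta> \<beta> by (simp add: c_def)
  have "U \<ge> 0" using \<Psi>[of 0] L by linarith
  have \<phi>_ge: "L \<le> \<phi> x" for x
    unfolding \<phi>_def by (rule phi1_ge[OF \<delta> \<beta> L])
  \<comment> \<open>With the weight \<open>exp (2 * c * x)\<close>, each use of the integral inequality halves the bound.\<close>
  have iter: "\<Psi> x - \<phi> x \<le> (U / 2 ^ n) * exp (2 * c * x)" if "0 < x" "x < 1" for n x
    using that
  proof (induction n arbitrary: x)
    case 0
    have "U \<le> U * exp (2 * c * x)"
      using \<open>U \<ge> 0\<close> \<open>c > 0\<close> 0 by (simp add: mult_le_cancel_left1)
    moreover have "\<Psi> x - \<phi> x \<le> U"
      using \<Psi>(2)[of x] \<phi>_ge[of x] L by linarith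
    ultimately show ?case by simp
  next
    case (Suc n)
    define M where "M = U / 2 ^ n"
    have "M \<ge> 0" using \<open>U \<ge> 0\<close> by (simp add: M_def)
    have IH: "\<Psi> r \<le> \<phi> r + M * exp (2 * c * r)" if "0 < r" "r < 1" for r
      using Suc.IH[OF that] by (simp add: M_def)
    have goal: "\<Psi> x \<le> \<phi> x + M / 2 * exp (2 * c * x)"
    proof (cases "\<Psi> x \<le> \<phi> x")
      case True
      moreover have "0 \<le> M / 2 * exp (2 * c * x)" using \<open>M \<ge> 0\<close> by simp
      ultimately show ?thesis by linarith
    next
      case False
      then have "L < \<Psi> x" using \<phi>_ge[of x] by linarith
      define z where "z = x - (1 - \<delta>)"
      have le: "\<Psi> x \<le> c * (\<integral>r. indicator {0<..<z} r * \<Psi> r \<partial>lborel)"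
        unfolding c_def z_def by (rule sub) fact+
      have "z > 0"
      proof (rule ccontr)
        assume "\<not> z > 0"
        then have "\<Psi> x \<le> 0" using le by simp
        then show False using \<Psi>(1)[of x] L by linarith
      qed
      have z: "z \<le> x" "z < 1" using Suc.prems \<delta> by (simp_all add: z_def)
      have 1: "has_bochner_integral lborel (\<lambda>r. \<phi> r * indicator {0..z} r)
          (L * (z - \<delta> / \<beta> - max 0 (z - \<delta> / \<beta>)) + \<delta> / \<beta> * \<phi> x)"
        using has_bochner_integral_phi1[OF \<delta> \<beta>, of z L] \<open>z > 0\<close> by (simp add: \<phi>_def z_def)
      have 2: "has_bochner_integral lborel (\<lambda>r. M * exp (2 * c * r) * indicator {0..z} r)
          (M / (2 * c) * exp (2 * c * z) - M / (2 * c) * exp (2 * c * 0))"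
        using \<open>z > 0\<close> \<open>c > 0\<close>
        by (intro has_bochner_integral_FTC_Icc_real)
          (auto intro!: derivative_eq_intros continuous_intros)
      note 12 = has_bochner_integral_add[OF 1 2]
      have le2: "indicator {0<..<z} r * \<Psi> r \<le> \<phi> r * indicator {0..z} r + M * exp (2 * c * r) * indicator {0..z} r" for r
        using IH[of r] z \<phi>_ge[of r] \<open>M \<ge> 0\<close> L by (auto simp: indicator_def intro!: add_nonneg_nonneg)
      have "(\<integral>r. indicator {0<..<z} r * \<Psi> r \<partial>lborel) \<le>
          (\<integral>r. \<phi> r * indicator {0..z} r + M * exp (2 * c * r) * indicator {0..z} r \<partial>lborel)"
      proof (rule integral_mono')
        show "0 \<le> \<phi> r * indicator {0..z} r + M * exp (2 * c * r) * indicator {0..z} r" for r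
          using \<phi>_ge[of r] \<open>M \<ge> 0\<close> L by simp
      qed (use 12 le2 in \<open>simp_all add: has_bochner_integral_iff\<close>)
      also have "\<dots> = L * (z - \<delta> / \<beta> - max 0 (z - \<delta> / \<beta>)) + \<delta> / \<beta> * \<phi> x +
          (M / (2 * c) * exp (2 * c * z) - M / (2 * c) * exp (2 * c * 0))"
        by (rule has_bochner_integral_integral_eq[OF 12])
      \<comment> \<open>The correction term of the Volterra equation is at most 0, and the primitive
        of the weight carries the factor \<open>1 / (2 * c)\<close>; multiplying by \<open>c\<close>
        leaves the one half.\<close>
      also have "\<dots> \<le> \<phi> x / c + M / (2 * c) * exp (2 * c * x)"
      proof -
        have "L * (z - \<delta> / \<beta> - max 0 (z - \<delta> / \<beta>)) \<le> 0"
          using L by (intro mult_nonneg_nonpos) auto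
        moreover have "\<delta> / \<beta> * \<phi> x = \<phi> x / c" by (simp add: c_def)
        moreover have "0 \<le> M / (2 * c) * exp (2 * c * 0)" using \<open>M \<ge> 0\<close> \<open>c > 0\<close> by simp
        moreover have "M / (2 * c) * exp (2 * c * z) \<le> M / (2 * c) * exp (2 * c * x)"
          using \<open>M \<ge> 0\<close> \<open>c > 0\<close> z by (intro mult_left_mono) auto
        ultimately show ?thesis by linarith
      qed
      finally have "c * (\<integral>r. indicator {0<..<z} r * \<Psi> r \<partial>lborel) \<le> c * (\<phi> x / c + M / (2 * c) * exp (2 * c * x))"
        using \<open>c > 0\<close> by (intro mult_left_mono) auto
      also have "\<dots> = \<phi> x + M / 2 * exp (2 * c * x)"
        using \<open>c > 0\<close> by (simp add: field_simps)
      finally show ?thesis using le by linarith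
    qed
    then show ?case by (simp add: M_def)
  qed
  have "(\<lambda>n. U * exp (2 * c * x) * (1 / 2) ^ n) \<longlonglongrightarrow> U * exp (2 * c * x) * 0"
    by (intro tendsto_intros LIMSEQ_power_zero) simp
  then have "\<Psi> x - \<phi> x \<le> U * exp (2 * c * x) * 0"
    by (rule LIMSEQ_le_const) (use iter[OF x] in \<open>auto simp: power_one_over field_simps\<close>)
  then show ?thesis by (simp add: \<phi>_def)
qed

text \<open>Passage from extended to real numbers: the threshold 0 gives CVaR at least 0, a CVaR of
  0 would make the ratio infinite, and \<open>B\<close> excludes an infinite CVaR.\<close>

lemma opt_le_of_cvar_cr_le:
  assumes L: "0 < L" and k: "k \<ge> 1" and \<delta>: "0 < \<delta>" and vs: "vs \<in> instances L U"
    and cr: "static_cvar_cr L U k \<delta> D \<le> ereal \<beta>" and B: "static_cvar k \<delta> D vs \<le> ereal B"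
  shows "0 < \<beta> \<and> opt k vs \<le> \<beta> * B"
proof -
  define C where "C = static_cvar k \<delta> D vs"
  have pos: "0 < opt k vs" by (rule opt_pos[OF L vs k])
  have "(if C = 0 then \<infinity> else ereal (opt k vs) / C) \<le> static_cvar_cr L U k \<delta> D"
    unfolding static_cvar_cr_def C_def by (rule SUP_upper2[OF vs]) simp
  also note cr
  finally have ratio: "(if C = 0 then \<infinity> else ereal (opt k vs) / C) \<le> ereal \<beta>" .
  have "0 \<le> welfare k (\<lambda>t. P) vs" for P
    using vs L by (intro welfare_nonneg) (auto simp: instances_def)
  then have "max (0 - welfare k (\<lambda>t. P) vs) 0 = 0" for P
    by (simp add: max_def)
  then have "0 \<le> C"
    using cvar_ge[of 0 \<delta> D "\<lambda>P. welfare k (\<lambda>t. P) vs"] by (simp add: C_def static_cvar_def zero_ereal_def)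
  then obtain c where c: "C = ereal c" "0 < c"
    using B ratio by (cases C) (auto simp: C_def[symmetric] split: if_splits)
  then have "opt k vs / c \<le> \<beta>" using ratio by simp
  moreover from this have "0 < \<beta>" using pos c by (meson divide_pos_pos less_le_trans)
  moreover have "\<beta> * c \<le> \<beta> * B"
    using B c \<open>0 < \<beta>\<close> by (intro mult_left_mono) (auto simp: C_def)
  moreover have "opt k vs \<le> \<beta> * c"
    using \<open>opt k vs / c \<le> \<beta>\<close> c by (simp add: pos_divide_le_eq)
  ultimately show ?thesis by linarith
qed

text \<open>Obtained from the ascending instance up to \<open>v\<close> as the mesh tends to 0.
  Clipping at \<open>U\<close> bounds the integrand and changes nothing on the seeds integrated
  over, whose quantile is at most \<open>v\<close>.\<close>

lemma quantile_integral_ge: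
  assumes L: "0 < L" and v: "L \<le> v" "v \<le> U" and k: "k \<ge> 1" and \<delta>: "0 < \<delta>" "\<delta> \<le> 1"
    and D: "static_scheme D" and cr: "static_cvar_cr L U k \<delta> D \<le> ereal \<beta>"
  shows "0 < \<beta> \<and> v \<le> \<beta> / \<delta> * (\<integral>r. indicator {0<..<cdf D v - (1 - \<delta>)} r * min U (max L (quantile D r)) \<partial>lborel)"
proof -
  define c where "c = cdf D v - (1 - \<delta>)"
  define \<Psi> where "\<Psi> r = min U (max L (quantile D r))" for r
  note measurable_quantile[OF D, measurable]
  have c: "c \<le> cdf D v" "c \<le> 1" "cdf D v \<le> 1"
    using cdf_static_scheme_le_1[OF D, of v] \<delta> by (simp_all add: c_def)
  have \<Psi>: "L \<le> \<Psi> r" "\<Psi> r \<le> U" for r using v by (auto simp: \<Psi>_def)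
  have [measurable]: "\<Psi> \<in> borel_measurable borel" by (simp add: \<Psi>_def[abs_def])
  have int: "integrable lborel (\<lambda>r. indicator {0<..<c} r * (\<Psi> r + \<epsilon>))" for \<epsilon>
    by (rule integrable_indicator_Ioo_bounded[where B="U + \<bar>\<epsilon>\<bar>"]) (simp, use \<Psi> L in \<open>smt (verit)\<close>)
  have *: "0 < \<beta> \<and> v \<le> \<beta> / \<delta> * (\<integral>r. indicator {0<..<c} r * \<Psi> r \<partial>lborel) + \<beta> / \<delta> * \<epsilon>" if "\<epsilon> > 0" for \<epsilon>
  proof -
    obtain vs where vs: "vs \<in> instances L U" "opt k vs = real k * v"
      "\<And>p. welfare k (\<lambda>t. p) vs \<le> real k * (max L p + \<epsilon>)"
      "\<And>p. v < p \<Longrightarrow> welfare k (\<lambda>t. p) vs = 0"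
      using ascending_instance[OF L v k \<open>\<epsilon> > 0\<close>] by metis
    have W0: "0 \<le> welfare k (\<lambda>t. P) vs" for P
      using vs L by (intro welfare_nonneg) (auto simp: instances_def)
    have WB: "welfare k (\<lambda>t. p) vs \<le> real k * (v + \<epsilon>)" for p
    proof (cases "p \<le> v")
      case True
      then have "real k * (max L p + \<epsilon>) \<le> real k * (v + \<epsilon>)" using v by (intro mult_left_mono) auto
      then show ?thesis using vs(3)[of p] by linarith
    next
      case False
      then show ?thesis using vs(4)[of p] v L that by simp
    qed
    have le: "indicator {0<..<c} r * welfare k (\<lambda>t. quantile D r) vs \<le> real k * (indicator {0<..<c} r * (\<Psi> r + \<epsilon>))" for r
    proof (cases "0 < r \<and> r < c")
      case True
      then have "quantile D r \<le> v" using quantile_le_iff[OF D, of r v] c by auto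
      then have "\<Psi> r = max L (quantile D r)" using v by (simp add: \<Psi>_def)
      then show ?thesis using True vs(3)[of "quantile D r"] by simp
    qed auto
    have "static_cvar k \<delta> D vs \<le> ereal (1 / \<delta> * (\<integral>r. indicator {0<..<c} r * welfare k (\<lambda>t. quantile D r) vs \<partial>lborel))"
      unfolding static_cvar_def c_def
      by (rule cvar_le_quantile_integral[OF D \<delta> measurable_welfare W0 WB vs(4)])
    then have "0 < \<beta> \<and> opt k vs \<le> \<beta> * (1 / \<delta> * (\<integral>r. indicator {0<..<c} r * welfare k (\<lambda>t. quantile D r) vs \<partial>lborel))"
      by (rule opt_le_of_cvar_cr_le[OF L k \<delta>(1) vs(1) cr])
    then have \<beta>: "0 < \<beta>" and opt: "opt k vs \<le> \<beta> / \<delta> * (\<integral>r. indicator {0<..<c} r * welfare k (\<lambda>t. quantile D r) vs \<partial>lborel)"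
      by simp_all
    note opt
    also have "(\<integral>r. indicator {0<..<c} r * welfare k (\<lambda>t. quantile D r) vs \<partial>lborel) \<le>
        (\<integral>r. real k * (indicator {0<..<c} r * (\<Psi> r + \<epsilon>)) \<partial>lborel)"
    proof (intro integral_mono' le mult_nonneg_nonneg)
      show "0 \<le> \<Psi> r + \<epsilon>" for r using \<Psi>(1)[of r] L that by linarith
    qed (use int in auto)
    also have "\<dots> = real k * ((\<integral>r. indicator {0<..<c} r * \<Psi> r \<partial>lborel) + \<epsilon> * measure lborel {0<..<c})"
    proof -
      have "integrable lborel (\<lambda>r. indicator {0<..<c} r * \<epsilon>)"
        by (rule integrable_indicator_Ioo_bounded[where B="\<bar>\<epsilon>\<bar>"]) auto
      then have "(\<integral>r. indicator {0<..<c} r * \<Psi> r + indicator {0<..<c} r * \<epsilon> \<partial>lborel) =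
          (\<integral>r. indicator {0<..<c} r * \<Psi> r \<partial>lborel) + (\<integral>r. indicator {0<..<c} r * \<epsilon> \<partial>lborel)"
        using int[of 0] by (intro Bochner_Integration.integral_add) simp_all
      then show ?thesis
        by (simp only: distrib_left[of "indicator _ _"] integral_mult_right_zero) simp
    qed
    also have "\<dots> \<le> real k * ((\<integral>r. indicator {0<..<c} r * \<Psi> r \<partial>lborel) + \<epsilon>)"
      using that c by (intro mult_left_mono add_left_mono) (cases "0 \<le> c"; simp add: mult_left_le)+
    finally have "real k * v \<le> \<beta> / \<delta> * (real k * ((\<integral>r. indicator {0<..<c} r * \<Psi> r \<partial>lborel) + \<epsilon>))"
      using \<beta> \<delta> vs(2) by (simp add: mult_left_mono divide_right_mono)
    also have "\<dots> = real k * (\<beta> / \<delta> * (\<integral>r. indicator {0<..<c} r * \<Psi> r \<partial>lborel) + \<beta> / \<delta> * \<epsilon>)"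
      by (simp add: algebra_simps add_divide_distrib)
    finally show ?thesis using \<beta> k by simp
  qed
  have \<beta>: "0 < \<beta>" using *[of 1] by simp
  have "v \<le> \<beta> / \<delta> * (\<integral>r. indicator {0<..<c} r * \<Psi> r \<partial>lborel)"
  proof (rule field_le_epsilon)
    fix e :: real assume "e > 0"
    \<comment> \<open>The mesh is chosen so that the error term becomes exactly
      \<open>e\<close>.\<close>
    then have "v \<le> \<beta> / \<delta> * (\<integral>r. indicator {0<..<c} r * \<Psi> r \<partial>lborel) + \<beta> / \<delta> * (e * \<delta> / \<beta>)"
      using *[of "e * \<delta> / \<beta>"] \<beta> \<delta> by simp
    then show "v \<le> \<beta> / \<delta> * (\<integral>r. indicator {0<..<c} r * \<Psi> r \<partial>lborel) + e"
      using \<beta> \<delta> by simp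
  qed
  with \<beta> show ?thesis by (simp add: \<Psi>_def c_def)
qed

lemma static_cvar_cr_ge:
  assumes L: "0 < L" and LU: "L \<le> U" and k: "k \<ge> 1" and \<delta>: "0 < \<delta>" "\<delta> \<le> 1"
    and \<alpha>: "1 \<le> \<alpha>" "phi1 L \<delta> \<alpha> 1 = U" and D: "static_scheme D"
  shows "ereal \<alpha> \<le> static_cvar_cr L U k \<delta> D"
proof (rule ccontr)
  assume "\<not> ereal \<alpha> \<le> static_cvar_cr L U k \<delta> D"
  then obtain \<beta> where \<beta>: "static_cvar_cr L U k \<delta> D < ereal \<beta>" "ereal \<beta> < ereal \<alpha>"
    using ereal_dense2 by (metis not_le)
  define \<Psi> where "\<Psi> r = min U (max L (quantile D r))" for r
  have [measurable]: "\<Psi> \<in> borel_measurable borel"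
    using measurable_quantile[OF D] by (simp add: \<Psi>_def[abs_def])
  have \<Psi>: "L \<le> \<Psi> r" "\<Psi> r \<le> U" for r using LU by (auto simp: \<Psi>_def)
  have key: "0 < \<beta>" "v \<le> \<beta> / \<delta> * (\<integral>r. indicator {0<..<cdf D v - (1 - \<delta>)} r * \<Psi> r \<partial>lborel)"
    if "L \<le> v" "v \<le> U" for v
    using quantile_integral_ge[OF L that k \<delta> D less_imp_le[OF \<beta>(1)]] by (simp_all add: \<Psi>_def)
  have "0 < \<beta>" by (rule key(1)[of L]) (use LU in auto)
  have int: "integrable lborel (\<lambda>r. indicator {0<..<c} r * \<Psi> r)" for c
    by (rule integrable_indicator_Ioo_bounded[where B=U]) (simp, use \<Psi> L in \<open>smt (verit)\<close>)
  have mono: "(\<integral>r. indicator {0<..<c} r * \<Psi> r \<partial>lborel) \<le> (\<integral>r. indicator {0<..<c'} r * \<Psi> r \<partial>lborel)"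
    if "c \<le> c'" for c c'
    using that less_le_trans[OF L \<Psi>(1)]
    by (intro integral_mono int) (auto simp: indicator_def less_imp_le)
  \<comment> \<open>The facts on \<open>phi1 L \<delta> \<beta>\<close> presuppose this. It follows
    from \<open>v = L\<close>: the integrand is then \<open>L\<close>, on a set of measure at most
    \<open>\<delta>\<close>.\<close>
  have "1 \<le> \<beta>"
  proof -
    define c where "c = cdf D L - (1 - \<delta>)"
    have c: "c \<le> \<delta>" "c \<le> cdf D L" "cdf D L \<le> 1"
      using cdf_static_scheme_le_1[OF D, of L] \<delta> by (simp_all add: c_def)
    have "indicator {0<..<c} r * \<Psi> r = indicator {0<..<c} r * L" for r
    proof (cases "0 < r \<and> r < c")
      case True
      then have "quantile D r \<le> L" using quantile_le_iff[OF D, of r L] c by auto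
      then show ?thesis using LU by (simp add: \<Psi>_def)
    qed auto
    then have "(\<integral>r. indicator {0<..<c} r * \<Psi> r \<partial>lborel) = measure lborel {0<..<c} * L"
      by (simp only:) simp
    then have "L \<le> \<beta> / \<delta> * (measure lborel {0<..<c} * L)"
      using key(2)[of L] LU unfolding c_def[symmetric] by (simp only: order_refl)
    also have "\<dots> \<le> \<beta> / \<delta> * (\<delta> * L)"
      using c \<open>0 < \<beta>\<close> \<delta> L by (intro mult_left_mono mult_right_mono) (cases "0 \<le> c"; simp)+
    finally show ?thesis using L \<delta> by simp
  qed
  have cmp: "\<Psi> x \<le> phi1 L \<delta> \<beta> x" if x: "0 < x" "x < 1" for x
  proof (rule phi1_comparison[OF L \<delta> \<open>1 \<le> \<beta>\<close> _ \<Psi> _ x])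
    fix x :: real assume x: "0 < x" "x < 1" "L < \<Psi> x"
    show "\<Psi> x \<le> \<beta> / \<delta> * (\<integral>r. indicator {0<..<x - (1 - \<delta>)} r * \<Psi> r \<partial>lborel)"
    \<comment> \<open>From \<open>v < \<Psi> x\<close> follows \<open>cdf D v < x\<close>, so the
      integral for \<open>v\<close> extends to the one for \<open>x\<close>. Letting
      \<open>v\<close> rise to \<open>\<Psi> x\<close> avoids evaluating \<open>cdf D\<close> at a
      possible atom.\<close>
    proof (rule dense_le_bounded[OF \<open>L < \<Psi> x\<close>])
      fix v assume v: "L < v" "v < \<Psi> x"
      then have "v < quantile D x" "v \<le> U" by (auto simp: \<Psi>_def min_def max_def split: if_splits)
      then have "cdf D v < x" using quantile_le_iff[OF D, of x v] x by auto
      have "v \<le> \<beta> / \<delta> * (\<integral>r. indicator {0<..<cdf D v - (1 - \<delta>)} r * \<Psi> r \<partial>lborel)"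
        using key(2)[of v] v \<open>v \<le> U\<close> by simp
      also have "\<dots> \<le> \<beta> / \<delta> * (\<integral>r. indicator {0<..<x - (1 - \<delta>)} r * \<Psi> r \<partial>lborel)"
        using \<open>cdf D v < x\<close> \<open>0 < \<beta>\<close> \<delta> by (intro mult_left_mono mono) auto
      finally show "v \<le> \<dots>" .
    qed
  qed simp
  have "\<delta> / \<beta> \<le> \<delta>" using \<delta> \<open>1 \<le> \<beta>\<close> by (simp add: field_simps)
  then have phi: "has_bochner_integral lborel (\<lambda>r. phi1 L \<delta> \<beta> r * indicator {0..\<delta>} r) (\<delta> / \<beta> * phi1 L \<delta> \<beta> 1)"
    using has_bochner_integral_phi1[OF \<delta> \<open>1 \<le> \<beta>\<close>, of \<delta> L] \<delta> by simp
  \<comment> \<open>The comparison holds only inside the open unit interval, so its end 1 is reached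
    through the integral up to \<open>\<delta>\<close>, which by the Volterra equation is a multiple
    of \<open>phi1 L \<delta> \<beta> 1\<close>.\<close>
  have "U \<le> \<beta> / \<delta> * (\<integral>r. indicator {0<..<cdf D U - (1 - \<delta>)} r * \<Psi> r \<partial>lborel)"
    using key(2)[of U] LU by simp
  also have "\<dots> \<le> \<beta> / \<delta> * (\<integral>r. indicator {0<..<\<delta>} r * \<Psi> r \<partial>lborel)"
    using cdf_static_scheme_le_1[OF D, of U] \<open>0 < \<beta>\<close> \<delta> by (intro mult_left_mono mono) auto
  also have "\<dots> \<le> \<beta> / \<delta> * (\<integral>r. phi1 L \<delta> \<beta> r * indicator {0..\<delta>} r \<partial>lborel)"
  proof (intro mult_left_mono integral_mono int)
    show "indicator {0<..<\<delta>} r * \<Psi> r \<le> phi1 L \<delta> \<beta> r * indicator {0..\<delta>} r" for r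
      using cmp[of r] \<delta> less_le_trans[OF L phi1_ge[OF \<delta> \<open>1 \<le> \<beta>\<close> L, of r]] by (auto simp: indicator_def)
  qed (use phi \<open>0 < \<beta>\<close> \<delta> in \<open>auto simp: has_bochner_integral_iff\<close>)
  also have "\<dots> = phi1 L \<delta> \<beta> 1"
    using has_bochner_integral_integral_eq[OF phi] \<open>0 < \<beta>\<close> \<delta> by simp
  also have "\<dots> < U"
    using phi1_at_1_strict_mono[OF L \<delta> \<open>1 \<le> \<beta>\<close>, of \<alpha>] \<beta>(2) \<alpha> by simp
  finally show False by simp
qed

theorem theorem2:
  fixes L U \<delta> :: real and k :: nat
  assumes "0 < L" and "L \<le> U" and "k \<ge> 1" and "0 < \<delta>" and "\<delta> \<le> 1"
  shows "(\<exists>!\<alpha>. \<alpha> \<ge> 1 \<and> phi1 L \<delta> \<alpha> 1 = U) \<and>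
    static_scheme (cPPM_static (phi1 L \<delta> (alpha_SP L U \<delta>))) \<and>
    static_cvar_cr L U k \<delta> (cPPM_static (phi1 L \<delta> (alpha_SP L U \<delta>))) = ereal (alpha_SP L U \<delta>) \<and>
    (\<forall>D. static_scheme D \<longrightarrow> static_cvar_cr L U k \<delta> D \<ge> ereal (alpha_SP L U \<delta>))"
proof -
  note ex1 = ex1_phi1_at_1[OF assms(1,2,4,5)]
  define \<alpha> where "\<alpha> = alpha_SP L U \<delta>"
  have \<alpha>: "1 \<le> \<alpha>" "phi1 L \<delta> \<alpha> 1 = U"
    using theI'[OF ex1] by (simp_all add: \<alpha>_def alpha_SP_def)
  have scheme: "static_scheme (cPPM_static (phi1 L \<delta> \<alpha>))"
    using assms \<alpha> by (intro static_scheme_cPPM_static borel_measurable_mono mono_phi1)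
  note lower = static_cvar_cr_ge[OF assms \<alpha>]
  have "static_cvar_cr L U k \<delta> (cPPM_static (phi1 L \<delta> \<alpha>)) = ereal \<alpha>"
    using static_cvar_cr_cPPM_le[OF assms(1,4,5) \<alpha> assms(3)] lower[OF scheme] by (rule antisym)
  with ex1 scheme lower show ?thesis
    unfolding \<alpha>_def[symmetric] by blast
qed

end
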